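(* Let $k$ be a field, let $q \in k^\times$, and let $m,n$ be positive integers. Let $\mathcal{I}_1$ be the two-sided ideal of $\mathcal{O}_q(M_{m,n}(k))$ generated by all $2\times 2$ quantum minors. Then the $k$-algebra $\mathcal{O}_q(M_{m,n}(k))/\mathcal{I}_1$ is isomorphic to a subalgebra of the tensor product $\mathcal{O}_q(k^m)\otimes_k \mathcal{O}_q(k^n)$. In particular, $\mathcal{I}_1$ is a completely prime ideal of $\mathcal{O}_q(M_{m,n}(k))$.
   Context: The coordinate ring of quantum $m\times n$ matrices $\mathcal{O}_q(M_{m,n}(k))$ is the $k$-algebra generated by $X_{ij}$ ($1\le i\le m$, $1\le j\le n$) subject to the relations: $X_{ij}X_{lj}=qX_{lj}X_{ij}$ when $i<l$; $X_{ij}X_{is}=qX_{is}X_{ij}$ when $j<s$; $X_{is}X_{lj}=X_{lj}X_{is}$ when $i<l$ and $j<s$; $X_{ij}X_{ls}-X_{ls}X_{ij}=(q-q^{-1})X_{is}X_{lj}$ when $i<l$ and $j<s$. The $2\times 2$ quantum minors are the elements $X_{ij}X_{ls}-qX_{is}X_{lj}$ for $1\le i<l\le m$ and $1\le j<s\le n$. The coordinate ring of quantum affine $n$-space $\mathcal{O}_q(k^n)$ is the $k$-algebra generated by $y_1,\dots,y_n$ subject to the relations $y_iy_j=qy_jy_i$ for $1\le i<j\le n$. The tensor product of two $k$-algebras carries the usual multiplication $(a\otimes b)(a'\otimes b')=aa'\otimes bb'$. An ideal $P$ of a ring $R$ is completely prime if $R/P$ is a (not necessarily commutative) integral domain. 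*)

theory Defs
  imports "HOL-Algebra.QuotRing" "HOL-Algebra.Module" "HOL-Algebra.Subrings"
begin

text \<open>
  Algebras over \<open>K\<close> are records of the library type \<^typ>\<open>('k, 'a) module\<close>, which has both a
  ring structure and a scalar multiplication. The library locale \<^locale>\<open>algebra\<close> only covers
  commutative algebras, hence the following noncommutative version.
\<close>

locale assoc_algebra = module K A + ring A for K (structure) and A (structure) +
  assumes smult_mult_left:
      "\<lbrakk>c \<in> carrier K; x \<in> carrier A; y \<in> carrier A\<rbrakk>
        \<Longrightarrow> (c \<odot>\<^bsub>A\<^esub> x) \<otimes>\<^bsub>A\<^esub> y = c \<odot>\<^bsub>A\<^esub> (x \<otimes>\<^bsub>A\<^esub> y)"
    and smult_mult_right:
      "\<lbrakk>c \<in> carrier K; x \<in> carrier A; y \<in> carrier A\<rbrakk>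
        \<Longrightarrow> x \<otimes>\<^bsub>A\<^esub> (c \<odot>\<^bsub>A\<^esub> y) = c \<odot>\<^bsub>A\<^esub> (x \<otimes>\<^bsub>A\<^esub> y)"

definition alg_hom ::
  "('k, 'c) ring_scheme \<Rightarrow> ('k, 'a, 'd) module_scheme \<Rightarrow> ('k, 'b, 'e) module_scheme \<Rightarrow> ('a \<Rightarrow> 'b) set"
  where "alg_hom K A B =
    {h \<in> ring_hom A B. \<forall>c\<in>carrier K. \<forall>x\<in>carrier A. h (c \<odot>\<^bsub>A\<^esub> x) = c \<odot>\<^bsub>B\<^esub> h x}"

definition alg_iso ::
  "('k, 'c) ring_scheme \<Rightarrow> ('k, 'a, 'd) module_scheme \<Rightarrow> ('k, 'b, 'e) module_scheme \<Rightarrow> ('a \<Rightarrow> 'b) set"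
  where "alg_iso K A B = {h \<in> alg_hom K A B. bij_betw h (carrier A) (carrier B)}"

definition is_subalgebra ::
  "('k, 'c) ring_scheme \<Rightarrow> 'a set \<Rightarrow> ('k, 'a, 'd) module_scheme \<Rightarrow> bool"
  where "is_subalgebra K S A \<longleftrightarrow> subring S A \<and> submodule S K A"

definition noncomm_domain :: "('a, 'b) ring_scheme \<Rightarrow> bool"
  where "noncomm_domain R \<longleftrightarrow> ring R \<and> \<one>\<^bsub>R\<^esub> \<noteq> \<zero>\<^bsub>R\<^esub> \<and>
    (\<forall>a\<in>carrier R. \<forall>b\<in>carrier R. a \<otimes>\<^bsub>R\<^esub> b = \<zero>\<^bsub>R\<^esub> \<longrightarrow> a = \<zero>\<^bsub>R\<^esub> \<or> b = \<zero>\<^bsub>R\<^esub>)"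

definition completely_prime :: "'a set \<Rightarrow> ('a, 'b) ring_scheme \<Rightarrow> bool"
  where "completely_prime P R \<longleftrightarrow> ideal P R \<and> noncomm_domain (R Quot P)"

text \<open>
  The library quotient ring \<^term>\<open>A Quot I\<close> together with the scalar multiplication
  \<open>c \<odot> (I + x) = I + c \<odot> x\<close>.
\<close>

definition quot_alg :: "('k, 'a, 'd) module_scheme \<Rightarrow> 'a set \<Rightarrow> ('k, 'a set) module"
  where "quot_alg A I = ring.extend (A Quot I)
    (module.fields (\<lambda>c X. \<Union>x\<in>X. I +>\<^bsub>A\<^esub> (c \<odot>\<^bsub>A\<^esub> x)))"

text \<open>
  The monoid algebra \<open>K[M]\<close>: finitely supported functions on \<open>M\<close> with convolution.
  Its underlying module is the free \<open>K\<close>-module with basis \<open>M\<close>.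
\<close>

definition supp :: "('k, 'c) ring_scheme \<Rightarrow> ('m \<Rightarrow> 'k) \<Rightarrow> 'm set"
  where "supp K f = {x. f x \<noteq> \<zero>\<^bsub>K\<^esub>}"

definition monoid_algebra ::
  "('k, 'c) ring_scheme \<Rightarrow> ('m, 'd) monoid_scheme \<Rightarrow> ('k, 'm \<Rightarrow> 'k) module"
  where "monoid_algebra K M =
    \<lparr>carrier = {f. range f \<subseteq> carrier K \<and> finite (supp K f) \<and> supp K f \<subseteq> carrier M},
     mult = (\<lambda>f g z. \<Oplus>\<^bsub>K\<^esub>x\<in>supp K f. \<Oplus>\<^bsub>K\<^esub>y\<in>supp K g.
               if x \<otimes>\<^bsub>M\<^esub> y = z then f x \<otimes>\<^bsub>K\<^esub> g y else \<zero>\<^bsub>K\<^esub>),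
     one = (\<lambda>z. if z = \<one>\<^bsub>M\<^esub> then \<one>\<^bsub>K\<^esub> else \<zero>\<^bsub>K\<^esub>),
     zero = (\<lambda>z. \<zero>\<^bsub>K\<^esub>),
     add = (\<lambda>f g z. f z \<oplus>\<^bsub>K\<^esub> g z),
     smult = (\<lambda>c f z. c \<otimes>\<^bsub>K\<^esub> f z)\<rparr>"

definition basis_elt :: "('k, 'c) ring_scheme \<Rightarrow> 'm \<Rightarrow> 'm \<Rightarrow> 'k"
  where "basis_elt K x = (\<lambda>z. if z = x then \<one>\<^bsub>K\<^esub> else \<zero>\<^bsub>K\<^esub>)"


subsection \<open>Algebras given by generators and relations\<close>

definition free_monoid :: "'x set \<Rightarrow> 'x list monoid"
  where "free_monoid X = \<lparr>carrier = lists X, mult = (@), one = []\<rparr>"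

definition free_alg :: "('k, 'c) ring_scheme \<Rightarrow> 'x set \<Rightarrow> ('k, 'x list \<Rightarrow> 'k) module"
  where "free_alg K X = monoid_algebra K (free_monoid X)"

definition free_gen :: "('k, 'c) ring_scheme \<Rightarrow> 'x \<Rightarrow> 'x list \<Rightarrow> 'k"
  where "free_gen K x = basis_elt K [x]"

text \<open>A relation \<open>r = s\<close> is encoded by the element \<open>r - s\<close> of the free algebra.\<close>

definition presented_alg ::
  "('k, 'c) ring_scheme \<Rightarrow> 'x set \<Rightarrow> ('x list \<Rightarrow> 'k) set \<Rightarrow> ('k, ('x list \<Rightarrow> 'k) set) module"
  where "presented_alg K X Rel = quot_alg (free_alg K X) (Idl\<^bsub>free_alg K X\<^esub> Rel)"

definition presented_gen ::
  "('k, 'c) ring_scheme \<Rightarrow> 'x set \<Rightarrow> ('x list \<Rightarrow> 'k) set \<Rightarrow> 'x \<Rightarrow> ('x list \<Rightarrow> 'k) set"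
  where "presented_gen K X Rel x =
    (Idl\<^bsub>free_alg K X\<^esub> Rel) +>\<^bsub>free_alg K X\<^esub> free_gen K x"


subsection \<open>Tensor products of algebras\<close>

definition lin_span ::
  "('k, 'c) ring_scheme \<Rightarrow> ('k, 'a, 'd) module_scheme \<Rightarrow> 'a set \<Rightarrow> 'a set"
  where "lin_span K A S = \<Inter>{H. submodule H K A \<and> S \<subseteq> H}"

text \<open>
  The algebra \<open>K[A \<times> B]\<close> of the multiplicative monoid \<open>A \<times> B\<close> is, as a module, free on the set
  \<open>A \<times> B\<close>, and multiplies basis elements by \<open>(a, b) (a', b') = (a a', b b')\<close>. The tensor
  product is its quotient by the linear span of the bilinearity relations (which is an ideal).
\<close>

definition bilinear_rels ::
  "('k, 'c) ring_scheme \<Rightarrow> ('k, 'a, 'd) module_scheme \<Rightarrow> ('k, 'b, 'e) module_scheme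
    \<Rightarrow> ('a \<times> 'b \<Rightarrow> 'k) set"
  where "bilinear_rels K A B = (let F = monoid_algebra K (A \<times>\<times> B); e = basis_elt K in
    {e (a \<oplus>\<^bsub>A\<^esub> a', b) \<ominus>\<^bsub>F\<^esub> (e (a, b) \<oplus>\<^bsub>F\<^esub> e (a', b)) | a a' b.
        a \<in> carrier A \<and> a' \<in> carrier A \<and> b \<in> carrier B} \<union>
    {e (a, b \<oplus>\<^bsub>B\<^esub> b') \<ominus>\<^bsub>F\<^esub> (e (a, b) \<oplus>\<^bsub>F\<^esub> e (a, b')) | a b b'.
        a \<in> carrier A \<and> b \<in> carrier B \<and> b' \<in> carrier B} \<union>
    {e (c \<odot>\<^bsub>A\<^esub> a, b) \<ominus>\<^bsub>F\<^esub> (c \<odot>\<^bsub>F\<^esub> e (a, b)) | c a b.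
        c \<in> carrier K \<and> a \<in> carrier A \<and> b \<in> carrier B} \<union>
    {e (a, c \<odot>\<^bsub>B\<^esub> b) \<ominus>\<^bsub>F\<^esub> (c \<odot>\<^bsub>F\<^esub> e (a, b)) | c a b.
        c \<in> carrier K \<and> a \<in> carrier A \<and> b \<in> carrier B})"

definition tensor_alg ::
  "('k, 'c) ring_scheme \<Rightarrow> ('k, 'a, 'd) module_scheme \<Rightarrow> ('k, 'b, 'e) module_scheme
    \<Rightarrow> ('k, ('a \<times> 'b \<Rightarrow> 'k) set) module"
  where "tensor_alg K A B = (let F = monoid_algebra K (A \<times>\<times> B) in
    quot_alg F (lin_span K F (bilinear_rels K A B)))"


subsection \<open>Quantum matrices and quantum affine space\<close>

definition qmat_index :: "nat \<Rightarrow> nat \<Rightarrow> (nat \<times> nat) set"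
  where "qmat_index m n = {1..m} \<times> {1..n}"

definition qmat_rels ::
  "('k, 'c) ring_scheme \<Rightarrow> 'k \<Rightarrow> nat \<Rightarrow> nat \<Rightarrow> ((nat \<times> nat) list \<Rightarrow> 'k) set"
  where "qmat_rels K q m n =
    (let F = free_alg K (qmat_index m n); X = (\<lambda>i j. free_gen K (i, j)) in
      {X i j \<otimes>\<^bsub>F\<^esub> X l j \<ominus>\<^bsub>F\<^esub> q \<odot>\<^bsub>F\<^esub> (X l j \<otimes>\<^bsub>F\<^esub> X i j) | i l j.
          i \<in> {1..m} \<and> l \<in> {1..m} \<and> j \<in> {1..n} \<and> i < l} \<union>
      {X i j \<otimes>\<^bsub>F\<^esub> X i s \<ominus>\<^bsub>F\<^esub> q \<odot>\<^bsub>F\<^esub> (X i s \<otimes>\<^bsub>F\<^esub> X i j) | i j s.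
          i \<in> {1..m} \<and> j \<in> {1..n} \<and> s \<in> {1..n} \<and> j < s} \<union>
      {X i s \<otimes>\<^bsub>F\<^esub> X l j \<ominus>\<^bsub>F\<^esub> X l j \<otimes>\<^bsub>F\<^esub> X i s | i l j s.
          i \<in> {1..m} \<and> l \<in> {1..m} \<and> j \<in> {1..n} \<and> s \<in> {1..n} \<and> i < l \<and> j < s} \<union>
      {(X i j \<otimes>\<^bsub>F\<^esub> X l s \<ominus>\<^bsub>F\<^esub> X l s \<otimes>\<^bsub>F\<^esub> X i j)
          \<ominus>\<^bsub>F\<^esub> (q \<ominus>\<^bsub>K\<^esub> inv\<^bsub>K\<^esub> q) \<odot>\<^bsub>F\<^esub> (X i s \<otimes>\<^bsub>F\<^esub> X l j) | i l j s.
          i \<in> {1..m} \<and> l \<in> {1..m} \<and> j \<in> {1..n} \<and> s \<in> {1..n} \<and> i < l \<and> j < s})"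

definition qmat ::
  "('k, 'c) ring_scheme \<Rightarrow> 'k \<Rightarrow> nat \<Rightarrow> nat \<Rightarrow> ('k, ((nat \<times> nat) list \<Rightarrow> 'k) set) module"
  where "qmat K q m n = presented_alg K (qmat_index m n) (qmat_rels K q m n)"

definition qmat_gen ::
  "('k, 'c) ring_scheme \<Rightarrow> 'k \<Rightarrow> nat \<Rightarrow> nat \<Rightarrow> nat \<Rightarrow> nat \<Rightarrow> ((nat \<times> nat) list \<Rightarrow> 'k) set"
  where "qmat_gen K q m n i j = presented_gen K (qmat_index m n) (qmat_rels K q m n) (i, j)"

definition qminors2 ::
  "('k, 'c) ring_scheme \<Rightarrow> 'k \<Rightarrow> nat \<Rightarrow> nat \<Rightarrow> ((nat \<times> nat) list \<Rightarrow> 'k) set set"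
  where "qminors2 K q m n = (let R = qmat K q m n; X = qmat_gen K q m n in
    {X i j \<otimes>\<^bsub>R\<^esub> X l s \<ominus>\<^bsub>R\<^esub> q \<odot>\<^bsub>R\<^esub> (X i s \<otimes>\<^bsub>R\<^esub> X l j) | i l j s.
        1 \<le> i \<and> i < l \<and> l \<le> m \<and> 1 \<le> j \<and> j < s \<and> s \<le> n})"

definition qminor_ideal ::
  "('k, 'c) ring_scheme \<Rightarrow> 'k \<Rightarrow> nat \<Rightarrow> nat \<Rightarrow> ((nat \<times> nat) list \<Rightarrow> 'k) set set"
  where "qminor_ideal K q m n = Idl\<^bsub>qmat K q m n\<^esub> (qminors2 K q m n)"

definition qaff_rels :: "('k, 'c) ring_scheme \<Rightarrow> 'k \<Rightarrow> nat \<Rightarrow> (nat list \<Rightarrow> 'k) set"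
  where "qaff_rels K q n =
    (let F = free_alg K {1..n}; y = free_gen K in
      {y i \<otimes>\<^bsub>F\<^esub> y j \<ominus>\<^bsub>F\<^esub> q \<odot>\<^bsub>F\<^esub> (y j \<otimes>\<^bsub>F\<^esub> y i) | i j. 1 \<le> i \<and> i < j \<and> j \<le> n})"

definition qaff :: "('k, 'c) ring_scheme \<Rightarrow> 'k \<Rightarrow> nat \<Rightarrow> ('k, (nat list \<Rightarrow> 'k) set) module"
  where "qaff K q n = presented_alg K {1..n} (qaff_rels K q n)"


subsection \<open>Well-definedness\<close>

text \<open>
  Nothing below enters the definitions. It is checked that the monoid algebra, the presented algebras
  and the tensor product are associative unital \<open>K\<close>-algebras, that the linear span of the
  bilinearity relations is an ideal, and that \<^const>\<open>qminor_ideal\<close> is an ideal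
  (\<^const>\<open>genideal\<close> would be \<^const>\<open>UNIV\<close> if the ambient structure were not a ring).
\<close>

lemma (in abelian_monoid) finsum_swap:
  assumes "finite A" "finite B" "\<And>i j. i \<in> A \<Longrightarrow> j \<in> B \<Longrightarrow> f i j \<in> carrier G"
  shows "(\<Oplus>i\<in>A. \<Oplus>j\<in>B. f i j) = (\<Oplus>j\<in>B. \<Oplus>i\<in>A. f i j)"
  using assms(1,3)
proof (induction A rule: finite_induct)
  case empty
  then show ?case by simp
next
  case (insert a A)
  have "(\<Oplus>i\<in>insert a A. \<Oplus>j\<in>B. f i j) = (\<Oplus>j\<in>B. f a j) \<oplus> (\<Oplus>i\<in>A. \<Oplus>j\<in>B. f i j)"
    using insert by (subst finsum_insert) (auto intro!: finsum_closed)
  also have "\<dots> = (\<Oplus>j\<in>B. f a j) \<oplus> (\<Oplus>j\<in>B. \<Oplus>i\<in>A. f i j)"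
    using insert by simp
  also have "\<dots> = (\<Oplus>j\<in>B. f a j \<oplus> (\<Oplus>i\<in>A. f i j))"
    using insert by (subst finsum_addf) (auto intro!: finsum_closed)
  also have "\<dots> = (\<Oplus>j\<in>B. \<Oplus>i\<in>insert a A. f i j)"
    using insert by (intro finsum_cong') (auto intro!: finsum_closed)
  finally show ?case .
qed

locale mon_alg = cring K + M: monoid M for K (structure) and M
begin

abbreviation "F \<equiv> monoid_algebra K M"

lemma F_sel:
  "f \<in> carrier F \<Longrightarrow> f x \<in> carrier K"
  "f \<in> carrier F \<Longrightarrow> finite (supp K f)"
  "f \<in> carrier F \<Longrightarrow> x \<in> supp K f \<Longrightarrow> x \<in> carrier M"
  "f \<in> carrier F \<Longrightarrow> supp K f \<subseteq> carrier M"
  by (auto simp: monoid_algebra_def)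

lemma F_I:
  "\<lbrakk>\<And>x. f x \<in> carrier K; finite S; S \<subseteq> carrier M; \<And>x. x \<notin> S \<Longrightarrow> f x = \<zero>\<rbrakk> \<Longrightarrow> f \<in> carrier F"
  by (auto simp: monoid_algebra_def supp_def intro: finite_subset[of _ S])

lemma F_ops:
  "\<zero>\<^bsub>F\<^esub> = (\<lambda>z. \<zero>)" "f \<oplus>\<^bsub>F\<^esub> g = (\<lambda>z. f z \<oplus> g z)" "c \<odot>\<^bsub>F\<^esub> f = (\<lambda>z. c \<otimes> f z)"
  "\<one>\<^bsub>F\<^esub> = basis_elt K \<one>\<^bsub>M\<^esub>"
  by (auto simp: monoid_algebra_def basis_elt_def)

definition pair where "pair f \<phi> = (\<Oplus>x\<in>supp K f. f x \<otimes> \<phi> x)"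

lemma pair_superset:
  assumes "f \<in> carrier F" "finite S" "supp K f \<subseteq> S" "\<And>x. x \<in> S \<Longrightarrow> \<phi> x \<in> carrier K"
  shows "pair f \<phi> = (\<Oplus>x\<in>S. f x \<otimes> \<phi> x)"
  unfolding pair_def
  by (rule add.finprod_mono_neutral_cong_left) (use assms F_sel in \<open>auto simp: supp_def\<close>)

lemma pair_closed [simp]:
  "f \<in> carrier F \<Longrightarrow> (\<And>x. x \<in> carrier M \<Longrightarrow> \<phi> x \<in> carrier K) \<Longrightarrow> pair f \<phi> \<in> carrier K"
  unfolding pair_def by (intro finsum_closed) (auto simp: F_sel)

lemma pair_cong:
  "f \<in> carrier F \<Longrightarrow> (\<And>x. x \<in> carrier M \<Longrightarrow> \<phi> x \<in> carrier K) \<Longrightarrow>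
   (\<And>x. x \<in> carrier M \<Longrightarrow> \<phi> x = \<psi> x) \<Longrightarrow> pair f \<phi> = pair f \<psi>"
  unfolding pair_def by (intro finsum_cong') (auto simp: F_sel)

lemma pair_add:
  assumes "f \<in> carrier F" "g \<in> carrier F" "\<And>x. x \<in> carrier M \<Longrightarrow> \<phi> x \<in> carrier K"
  shows "pair (f \<oplus>\<^bsub>F\<^esub> g) \<phi> = pair f \<phi> \<oplus> pair g \<phi>"
proof -
  let ?S = "supp K f \<union> supp K g"
  have c: "f \<oplus>\<^bsub>F\<^esub> g \<in> carrier F"
    by (rule F_I[of _ ?S]) (use assms F_sel in \<open>auto simp: F_ops supp_def\<close>)
  have fin: "finite ?S" and s: "\<And>x. x\<in>?S \<Longrightarrow> x \<in> carrier M" using assms F_sel by auto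
  have s2: "supp K (f \<oplus>\<^bsub>F\<^esub> g) \<subseteq> ?S" using assms by (auto simp: F_ops supp_def)
  have "pair (f \<oplus>\<^bsub>F\<^esub> g) \<phi> = (\<Oplus>x\<in>?S. f x \<otimes> \<phi> x \<oplus> g x \<otimes> \<phi> x)"
  proof -
    have "pair (f \<oplus>\<^bsub>F\<^esub> g) \<phi> = (\<Oplus>x\<in>?S. (f \<oplus>\<^bsub>F\<^esub> g) x \<otimes> \<phi> x)"
      by (rule pair_superset) (use c fin s s2 assms in auto)
    also have "\<dots> = (\<Oplus>x\<in>?S. f x \<otimes> \<phi> x \<oplus> g x \<otimes> \<phi> x)"
      by (intro finsum_cong') (use s assms in \<open>auto simp: F_ops l_distr F_sel\<close>)
    finally show ?thesis .
  qed
  also have "\<dots> = (\<Oplus>x\<in>?S. f x \<otimes> \<phi> x) \<oplus> (\<Oplus>x\<in>?S. g x \<otimes> \<phi> x)"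
    by (rule finsum_addf) (use s assms in \<open>auto simp: F_sel\<close>)
  also have "\<dots> = pair f \<phi> \<oplus> pair g \<phi>"
    using fin s assms by (subst (1 2) pair_superset[of _ ?S]) auto
  finally show ?thesis .
qed

lemma pair_add2:
  assumes "f \<in> carrier F" "\<And>x. x \<in> carrier M \<Longrightarrow> \<phi> x \<in> carrier K" "\<And>x. x \<in> carrier M \<Longrightarrow> \<psi> x \<in> carrier K"
  shows "pair f (\<lambda>x. \<phi> x \<oplus> \<psi> x) = pair f \<phi> \<oplus> pair f \<psi>"
proof -
  have "pair f (\<lambda>x. \<phi> x \<oplus> \<psi> x) = (\<Oplus>x\<in>supp K f. f x \<otimes> \<phi> x \<oplus> f x \<otimes> \<psi> x)"
    unfolding pair_def by (intro finsum_cong') (use assms in \<open>auto simp: F_sel r_distr\<close>)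
  also have "\<dots> = pair f \<phi> \<oplus> pair f \<psi>"
    unfolding pair_def by (rule finsum_addf) (use assms in \<open>auto simp: F_sel\<close>)
  finally show ?thesis .
qed

lemma pair_smult2:
  assumes "f \<in> carrier F" "\<And>x. x \<in> carrier M \<Longrightarrow> \<phi> x \<in> carrier K" "c \<in> carrier K"
  shows "pair f (\<lambda>x. c \<otimes> \<phi> x) = c \<otimes> pair f \<phi>"
proof -
  have "c \<otimes> pair f \<phi> = (\<Oplus>x\<in>supp K f. c \<otimes> (f x \<otimes> \<phi> x))"
    unfolding pair_def by (rule finsum_rdistr) (use assms in \<open>auto simp: F_sel\<close>)
  also have "\<dots> = pair f (\<lambda>x. c \<otimes> \<phi> x)"
    unfolding pair_def by (intro finsum_cong') (use assms in \<open>auto simp: F_sel m_lcomm\<close>)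
  finally show ?thesis by simp
qed

lemma smult_closed':
  assumes "f \<in> carrier F" "c \<in> carrier K" shows "c \<odot>\<^bsub>F\<^esub> f \<in> carrier F"
  by (rule F_I[of _ "supp K f"]) (use assms F_sel in \<open>auto simp: F_ops supp_def\<close>)

lemma pair_smult:
  assumes "f \<in> carrier F" "\<And>x. x \<in> carrier M \<Longrightarrow> \<phi> x \<in> carrier K" "c \<in> carrier K"
  shows "pair (c \<odot>\<^bsub>F\<^esub> f) \<phi> = c \<otimes> pair f \<phi>"
proof -
  let ?S = "supp K f"
  have "pair (c \<odot>\<^bsub>F\<^esub> f) \<phi> = (\<Oplus>x\<in>?S. (c \<odot>\<^bsub>F\<^esub> f) x \<otimes> \<phi> x)"
    by (rule pair_superset) (use assms F_sel smult_closed' in \<open>auto simp: F_ops supp_def\<close>)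
  also have "\<dots> = (\<Oplus>x\<in>?S. c \<otimes> (f x \<otimes> \<phi> x))"
    by (intro finsum_cong') (use assms in \<open>auto simp: F_sel m_assoc F_ops\<close>)
  also have "\<dots> = c \<otimes> pair f \<phi>"
    unfolding pair_def by (rule finsum_rdistr[symmetric]) (use assms in \<open>auto simp: F_sel\<close>)
  finally show ?thesis .
qed

lemma mult_pair:
  assumes "f \<in> carrier F" "g \<in> carrier F"
  shows "(f \<otimes>\<^bsub>F\<^esub> g) z = pair f (\<lambda>x. pair g (\<lambda>y. basis_elt K (x \<otimes>\<^bsub>M\<^esub> y) z))"
proof -
  have "(f \<otimes>\<^bsub>F\<^esub> g) z = (\<Oplus>x\<in>supp K f. \<Oplus>y\<in>supp K g. if x \<otimes>\<^bsub>M\<^esub> y = z then f x \<otimes> g y else \<zero>)"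
    by (simp add: monoid_algebra_def)
  also have "\<dots> = (\<Oplus>x\<in>supp K f. \<Oplus>y\<in>supp K g. f x \<otimes> (g y \<otimes> basis_elt K (x \<otimes>\<^bsub>M\<^esub> y) z))"
    by (intro finsum_cong') (use assms in \<open>auto simp: basis_elt_def F_sel intro!: finsum_cong' finsum_closed\<close>)
  also have "\<dots> = pair f (\<lambda>x. pair g (\<lambda>y. basis_elt K (x \<otimes>\<^bsub>M\<^esub> y) z))"
    unfolding pair_def
    by (intro finsum_cong' finsum_rdistr[symmetric])
      (use assms in \<open>auto simp: basis_elt_def F_sel intro!: finsum_closed\<close>)
  finally show ?thesis .
qed

lemma basis_closed [simp]: "basis_elt K x z \<in> carrier K" by (simp add: basis_elt_def)

lemma mult_closed':
  assumes "f \<in> carrier F" "g \<in> carrier F"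
  shows "f \<otimes>\<^bsub>F\<^esub> g \<in> carrier F"
proof (rule F_I[of _ "(\<lambda>(x,y). x \<otimes>\<^bsub>M\<^esub> y) ` (supp K f \<times> supp K g)"])
  fix z assume z: "z \<notin> (\<lambda>(x,y). x \<otimes>\<^bsub>M\<^esub> y) ` (supp K f \<times> supp K g)"
  have "(\<Oplus>x\<in>supp K f. \<Oplus>y\<in>supp K g. if x \<otimes>\<^bsub>M\<^esub> y = z then f x \<otimes> g y else \<zero>) = (\<Oplus>x\<in>supp K f. \<Oplus>y\<in>supp K g. \<zero>)"
    by (intro finsum_cong') (use z in \<open>auto intro!: finsum_cong'\<close>)
  then show "(f \<otimes>\<^bsub>F\<^esub> g) z = \<zero>" by (simp add: monoid_algebra_def)
next
  show "finite ((\<lambda>(x,y). x \<otimes>\<^bsub>M\<^esub> y) ` (supp K f \<times> supp K g))" using assms F_sel by auto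
  show "(\<lambda>(x,y). x \<otimes>\<^bsub>M\<^esub> y) ` (supp K f \<times> supp K g) \<subseteq> carrier M" using assms F_sel by auto
  show "(f \<otimes>\<^bsub>F\<^esub> g) z \<in> carrier K" for z using assms by (simp add: mult_pair)
qed

lemma pair_finsum:
  assumes "f \<in> carrier F" "g \<in> carrier F" "\<And>x. x \<in> carrier M \<Longrightarrow> \<phi> x \<in> carrier K"
  shows "pair f (\<lambda>x. pair g (\<lambda>y. \<phi> (x \<otimes>\<^bsub>M\<^esub> y))) = pair (f \<otimes>\<^bsub>F\<^esub> g) \<phi>"
proof -
  let ?S = "supp K f" and ?T = "supp K g"
  let ?W = "(\<lambda>(x,y). x \<otimes>\<^bsub>M\<^esub> y) ` (?S \<times> ?T)"
  let ?b = "\<lambda>x y w. basis_elt K (x \<otimes>\<^bsub>M\<^esub> y) w"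
  have W: "finite ?W" "?W \<subseteq> carrier M" using assms F_sel by auto
  have sw: "supp K (f \<otimes>\<^bsub>F\<^esub> g) \<subseteq> ?W"
  proof (rule ccontr)
    assume "\<not> ?thesis"
    then obtain z where z: "z \<notin> ?W" "(f \<otimes>\<^bsub>F\<^esub> g) z \<noteq> \<zero>" by (auto simp: supp_def)
    have "(\<Oplus>x\<in>?S. \<Oplus>y\<in>?T. if x \<otimes>\<^bsub>M\<^esub> y = z then f x \<otimes> g y else \<zero>) = (\<Oplus>x\<in>?S. \<Oplus>y\<in>?T. \<zero>)"
      by (intro finsum_cong') (use z in \<open>auto intro!: finsum_cong'\<close>)
    with z show False by (simp add: monoid_algebra_def)
  qed
  have "pair (f \<otimes>\<^bsub>F\<^esub> g) \<phi> = (\<Oplus>w\<in>?W. (f \<otimes>\<^bsub>F\<^esub> g) w \<otimes> \<phi> w)"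
    by (rule pair_superset) (use W sw mult_closed' assms in auto)
  also have "\<dots> = (\<Oplus>w\<in>?W. \<Oplus>x\<in>?S. f x \<otimes> (\<Oplus>y\<in>?T. g y \<otimes> (?b x y w \<otimes> \<phi> w)))"
  proof (intro finsum_cong')
    fix w assume w: "w \<in> ?W"
    hence pw: "\<phi> w \<in> carrier K" using W assms by auto
    have "(f \<otimes>\<^bsub>F\<^esub> g) w \<otimes> \<phi> w = \<phi> w \<otimes> (f \<otimes>\<^bsub>F\<^esub> g) w"
      using pw mult_closed'[OF assms(1,2)] by (simp add: m_comm F_sel)
    also have "\<dots> = pair f (\<lambda>x. pair g (\<lambda>y. \<phi> w \<otimes> ?b x y w))"
      using pw assms by (simp add: mult_pair pair_smult2)
    also have "\<dots> = (\<Oplus>x\<in>?S. f x \<otimes> (\<Oplus>y\<in>?T. g y \<otimes> (?b x y w \<otimes> \<phi> w)))"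
      unfolding pair_def using pw assms by (simp add: m_comm)
    finally show "(f \<otimes>\<^bsub>F\<^esub> g) w \<otimes> \<phi> w = \<dots>" .
  qed (use assms W in \<open>auto simp: F_sel intro!: finsum_closed\<close>)
  also have "\<dots> = (\<Oplus>w\<in>?W. \<Oplus>x\<in>?S. \<Oplus>y\<in>?T. f x \<otimes> (g y \<otimes> (?b x y w \<otimes> \<phi> w)))"
    by (intro finsum_cong' finsum_rdistr) (use assms W in \<open>auto simp: F_sel intro!: finsum_closed\<close>)
  also have "\<dots> = (\<Oplus>x\<in>?S. \<Oplus>w\<in>?W. \<Oplus>y\<in>?T. f x \<otimes> (g y \<otimes> (?b x y w \<otimes> \<phi> w)))"
    by (intro finsum_swap) (use assms W in \<open>auto simp: F_sel intro!: finsum_closed\<close>)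
  also have "\<dots> = (\<Oplus>x\<in>?S. \<Oplus>y\<in>?T. \<Oplus>w\<in>?W. f x \<otimes> (g y \<otimes> (?b x y w \<otimes> \<phi> w)))"
    by (intro finsum_cong' finsum_swap) (use assms W in \<open>auto simp: F_sel intro!: finsum_closed\<close>)
  also have "\<dots> = (\<Oplus>x\<in>?S. \<Oplus>y\<in>?T. f x \<otimes> (g y \<otimes> \<phi> (x \<otimes>\<^bsub>M\<^esub> y)))"
  proof (intro finsum_cong')
    fix x y assume xy: "x \<in> ?S" "y \<in> ?T"
    have "(\<Oplus>w\<in>?W. f x \<otimes> (g y \<otimes> (?b x y w \<otimes> \<phi> w)))
        = (\<Oplus>w\<in>?W. if x \<otimes>\<^bsub>M\<^esub> y = w then f x \<otimes> (g y \<otimes> \<phi> w) else \<zero>)"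
      by (intro finsum_cong') (use assms W xy in \<open>auto simp: F_sel basis_elt_def\<close>)
    also have "\<dots> = f x \<otimes> (g y \<otimes> \<phi> (x \<otimes>\<^bsub>M\<^esub> y))"
      by (rule finsum_singleton) (use assms W xy in \<open>auto simp: F_sel\<close>)
    finally show "(\<Oplus>w\<in>?W. f x \<otimes> (g y \<otimes> (?b x y w \<otimes> \<phi> w))) = \<dots>" .
  qed (use assms in \<open>auto simp: F_sel intro!: finsum_closed\<close>)
  also have "\<dots> = pair f (\<lambda>x. pair g (\<lambda>y. \<phi> (x \<otimes>\<^bsub>M\<^esub> y)))"
    unfolding pair_def
    by (intro finsum_cong' finsum_rdistr[symmetric]) (use assms in \<open>auto simp: F_sel intro!: finsum_closed\<close>)
  finally show ?thesis by simp
qed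

lemma pair_basis:
  "x \<in> carrier M \<Longrightarrow> (\<And>x. x \<in> carrier M \<Longrightarrow> \<phi> x \<in> carrier K) \<Longrightarrow> pair (basis_elt K x) \<phi> = \<phi> x"
proof -
  assume x: "x \<in> carrier M" and p: "\<And>x. x \<in> carrier M \<Longrightarrow> \<phi> x \<in> carrier K"
  have b: "basis_elt K x \<in> carrier F" by (rule F_I[of _ "{x}"]) (use x in \<open>auto simp: basis_elt_def\<close>)
  have "pair (basis_elt K x) \<phi> = (\<Oplus>y\<in>{x}. basis_elt K x y \<otimes> \<phi> y)"
    by (rule pair_superset) (use b x p in \<open>auto simp: supp_def basis_elt_def\<close>)
  also have "\<dots> = \<phi> x" using x p by (simp add: basis_elt_def)
  finally show ?thesis .
qed

lemma basis_F: "x \<in> carrier M \<Longrightarrow> basis_elt K x \<in> carrier F"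
  by (rule F_I[of _ "{x}"]) (auto simp: basis_elt_def)

lemma pair_delta:
  assumes "f \<in> carrier F" shows "pair f (\<lambda>x. basis_elt K x z) = f z"
proof (cases "z \<in> supp K f")
  case True
  have "pair f (\<lambda>x. basis_elt K x z) = (\<Oplus>x\<in>supp K f. if z = x then f x else \<zero>)"
    unfolding pair_def by (intro finsum_cong') (use assms in \<open>auto simp: F_sel basis_elt_def\<close>)
  also have "\<dots> = f z" by (rule finsum_singleton) (use assms True in \<open>auto simp: F_sel\<close>)
  finally show ?thesis .
next
  case False
  have "pair f (\<lambda>x. basis_elt K x z) = (\<Oplus>x\<in>supp K f. \<zero>)"
    unfolding pair_def by (intro finsum_cong') (use assms False in \<open>auto simp: F_sel basis_elt_def\<close>)
  with False show ?thesis by (simp add: supp_def)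
qed

lemma F_algebra: "assoc_algebra K F"
proof -
  have addc: "f \<oplus>\<^bsub>F\<^esub> g \<in> carrier F" if "f \<in> carrier F" "g \<in> carrier F" for f g
    by (rule F_I[of _ "supp K f \<union> supp K g"]) (use that F_sel in \<open>auto simp: F_ops supp_def\<close>)
  have ab: "abelian_group F"
  proof (rule abelian_groupI)
    show "\<zero>\<^bsub>F\<^esub> \<in> carrier F" by (rule F_I[of _ "{}"]) (auto simp: F_ops)
    fix x assume x: "x \<in> carrier F"
    show "\<exists>y\<in>carrier F. y \<oplus>\<^bsub>F\<^esub> x = \<zero>\<^bsub>F\<^esub>"
      by (rule bexI[of _ "(\<ominus> \<one>) \<odot>\<^bsub>F\<^esub> x"])
        (use x in \<open>simp add: F_ops F_sel fun_eq_iff l_minus l_neg\<close>, rule smult_closed'[OF x], simp)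
  qed (auto simp: addc, auto simp: F_ops F_sel a_ac fun_eq_iff)
  have mon: "monoid F"
  proof (rule monoidI)
    show "\<one>\<^bsub>F\<^esub> \<in> carrier F" by (simp add: F_ops basis_F)
    fix f assume f: "f \<in> carrier F"
    show "\<one>\<^bsub>F\<^esub> \<otimes>\<^bsub>F\<^esub> f = f"
    proof
      fix z
      have "(\<one>\<^bsub>F\<^esub> \<otimes>\<^bsub>F\<^esub> f) z = pair f (\<lambda>y. basis_elt K (\<one>\<^bsub>M\<^esub> \<otimes>\<^bsub>M\<^esub> y) z)"
        using f by (simp add: F_ops mult_pair basis_F pair_basis)
      also have "\<dots> = pair f (\<lambda>y. basis_elt K y z)" by (intro pair_cong) (use f in auto)
      finally show "(\<one>\<^bsub>F\<^esub> \<otimes>\<^bsub>F\<^esub> f) z = f z" using f by (simp add: pair_delta)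
    qed
    show "f \<otimes>\<^bsub>F\<^esub> \<one>\<^bsub>F\<^esub> = f"
    proof
      fix z
      have "(f \<otimes>\<^bsub>F\<^esub> \<one>\<^bsub>F\<^esub>) z = pair f (\<lambda>y. basis_elt K (y \<otimes>\<^bsub>M\<^esub> \<one>\<^bsub>M\<^esub>) z)"
        using f by (simp add: F_ops mult_pair basis_F pair_basis)
      also have "\<dots> = pair f (\<lambda>y. basis_elt K y z)" by (intro pair_cong) (use f in auto)
      finally show "(f \<otimes>\<^bsub>F\<^esub> \<one>\<^bsub>F\<^esub>) z = f z" using f by (simp add: pair_delta)
    qed
    fix g h assume gh: "g \<in> carrier F" "h \<in> carrier F"
    show "f \<otimes>\<^bsub>F\<^esub> g \<otimes>\<^bsub>F\<^esub> h = f \<otimes>\<^bsub>F\<^esub> (g \<otimes>\<^bsub>F\<^esub> h)"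
    proof
      fix z
      have "(f \<otimes>\<^bsub>F\<^esub> g \<otimes>\<^bsub>F\<^esub> h) z = pair (f \<otimes>\<^bsub>F\<^esub> g) (\<lambda>w. pair h (\<lambda>u. basis_elt K (w \<otimes>\<^bsub>M\<^esub> u) z))"
        using f gh by (intro mult_pair mult_closed')
      also have "\<dots> = pair f (\<lambda>x. pair g (\<lambda>y. pair h (\<lambda>u. basis_elt K (x \<otimes>\<^bsub>M\<^esub> y \<otimes>\<^bsub>M\<^esub> u) z)))"
        using f gh by (intro pair_finsum[symmetric]) auto
      also have "\<dots> = pair f (\<lambda>x. pair g (\<lambda>y. pair h (\<lambda>u. basis_elt K (x \<otimes>\<^bsub>M\<^esub> (y \<otimes>\<^bsub>M\<^esub> u)) z)))"
        using f gh by (intro pair_cong) (auto simp: M.m_assoc)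
      also have "\<dots> = pair f (\<lambda>x. pair (g \<otimes>\<^bsub>F\<^esub> h) (\<lambda>v. basis_elt K (x \<otimes>\<^bsub>M\<^esub> v) z))"
        using f gh by (intro pair_cong pair_finsum) auto
      also have "\<dots> = (f \<otimes>\<^bsub>F\<^esub> (g \<otimes>\<^bsub>F\<^esub> h)) z"
        using f gh by (intro mult_pair[symmetric] mult_closed')
      finally show "(f \<otimes>\<^bsub>F\<^esub> g \<otimes>\<^bsub>F\<^esub> h) z = (f \<otimes>\<^bsub>F\<^esub> (g \<otimes>\<^bsub>F\<^esub> h)) z" .
    qed
  qed (rule mult_closed')
  have ring: "ring F"
  proof (rule ringI[OF ab mon])
    fix f g h assume c: "f \<in> carrier F" "g \<in> carrier F" "h \<in> carrier F"
    show "(f \<oplus>\<^bsub>F\<^esub> g) \<otimes>\<^bsub>F\<^esub> h = f \<otimes>\<^bsub>F\<^esub> h \<oplus>\<^bsub>F\<^esub> g \<otimes>\<^bsub>F\<^esub> h"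
      using c by (intro ext) (simp add: mult_pair addc pair_add F_ops(2)[of "f \<otimes>\<^bsub>F\<^esub> h"])
    show "h \<otimes>\<^bsub>F\<^esub> (f \<oplus>\<^bsub>F\<^esub> g) = h \<otimes>\<^bsub>F\<^esub> f \<oplus>\<^bsub>F\<^esub> h \<otimes>\<^bsub>F\<^esub> g"
      using c by (intro ext) (simp add: mult_pair addc pair_add pair_add2 F_ops(2)[of "h \<otimes>\<^bsub>F\<^esub> f"])
  qed
  have mod: "module K F"
    by (rule moduleI) (use ab smult_closed' is_cring in \<open>auto simp: F_ops F_sel l_distr r_distr m_assoc fun_eq_iff\<close>)
  show ?thesis
  proof (intro assoc_algebra.intro mod ring assoc_algebra_axioms.intro)
    fix c f g assume c: "c \<in> carrier K" "f \<in> carrier F" "g \<in> carrier F"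
    show "(c \<odot>\<^bsub>F\<^esub> f) \<otimes>\<^bsub>F\<^esub> g = c \<odot>\<^bsub>F\<^esub> (f \<otimes>\<^bsub>F\<^esub> g)"
      using c by (intro ext) (simp add: mult_pair smult_closed' pair_smult F_ops(3)[of _ "f \<otimes>\<^bsub>F\<^esub> g"])
    show "f \<otimes>\<^bsub>F\<^esub> (c \<odot>\<^bsub>F\<^esub> g) = c \<odot>\<^bsub>F\<^esub> (f \<otimes>\<^bsub>F\<^esub> g)"
      using c by (intro ext) (simp add: mult_pair smult_closed' pair_smult pair_smult2 F_ops(3)[of _ "f \<otimes>\<^bsub>F\<^esub> g"])
  qed
qed

lemma basis_mult:
  "x \<in> carrier M \<Longrightarrow> y \<in> carrier M \<Longrightarrow> basis_elt K x \<otimes>\<^bsub>F\<^esub> basis_elt K y = basis_elt K (x \<otimes>\<^bsub>M\<^esub> y)"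
  by (rule ext) (simp add: mult_pair basis_F pair_basis)

end

lemma (in assoc_algebra) ideal_smult_closed:
  assumes "ideal I A" "c \<in> carrier K" "x \<in> I"
  shows "c \<odot>\<^bsub>A\<^esub> x \<in> I"
proof -
  interpret I: ideal I A by fact
  have "x \<in> carrier A" using assms I.Icarr by simp
  then have "c \<odot>\<^bsub>A\<^esub> x = (c \<odot>\<^bsub>A\<^esub> \<one>\<^bsub>A\<^esub>) \<otimes>\<^bsub>A\<^esub> x"
    using assms by (simp add: smult_mult_left)
  then show ?thesis using assms I.I_l_closed by simp
qed

lemma quot_alg_sel:
  "carrier (quot_alg A I) = carrier (A Quot I)"
  "mult (quot_alg A I) = mult (A Quot I)"
  "one (quot_alg A I) = one (A Quot I)"
  "zero (quot_alg A I) = zero (A Quot I)"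
  "add (quot_alg A I) = add (A Quot I)"
  "smult (quot_alg A I) = (\<lambda>c X. \<Union>x\<in>X. I +>\<^bsub>A\<^esub> (c \<odot>\<^bsub>A\<^esub> x))"
  by (simp_all add: quot_alg_def ring.defs module.defs FactRing_def)

lemma (in assoc_algebra) quot_smult_coset:
  assumes "ideal I A" "c \<in> carrier K" "x \<in> carrier A"
  shows "c \<odot>\<^bsub>quot_alg A I\<^esub> (I +>\<^bsub>A\<^esub> x) = I +>\<^bsub>A\<^esub> (c \<odot>\<^bsub>A\<^esub> x)"
proof -
  interpret I: ideal I A by fact
  have "I +>\<^bsub>A\<^esub> (c \<odot>\<^bsub>A\<^esub> y) = I +>\<^bsub>A\<^esub> (c \<odot>\<^bsub>A\<^esub> x)" if "y \<in> I +>\<^bsub>A\<^esub> x" for y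
  proof -
    from that obtain i where i: "i \<in> I" "y = i \<oplus>\<^bsub>A\<^esub> x" by (auto simp: a_r_coset_def')
    have ic: "i \<in> carrier A" using i I.Icarr by simp
    have "c \<odot>\<^bsub>A\<^esub> y = c \<odot>\<^bsub>A\<^esub> i \<oplus>\<^bsub>A\<^esub> c \<odot>\<^bsub>A\<^esub> x"
      using i ic assms by (simp add: smult_r_distr)
    moreover have "c \<odot>\<^bsub>A\<^esub> i \<in> I" using ideal_smult_closed assms i by blast
    ultimately have "c \<odot>\<^bsub>A\<^esub> y \<in> I +>\<^bsub>A\<^esub> (c \<odot>\<^bsub>A\<^esub> x)" by (auto simp: a_r_coset_def')
    then show ?thesis using assms I.a_repr_independence' by simp
  qed
  moreover have "x \<in> I +>\<^bsub>A\<^esub> x" using assms I.a_rcos_self by simp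
  ultimately show ?thesis unfolding quot_alg_sel by blast
qed

lemma (in assoc_algebra) quot_alg_assoc_algebra:
  assumes I: "ideal I A"
  shows "assoc_algebra K (quot_alg A I)"
proof -
  interpret I: ideal I A by fact
  let ?Q = "quot_alg A I"
  have cl: "X \<in> carrier ?Q \<longleftrightarrow> (\<exists>x\<in>carrier A. X = I +>\<^bsub>A\<^esub> x)" for X
    by (auto simp: quot_alg_sel FactRing_def A_RCOSETS_def')
  have m: "(I +>\<^bsub>A\<^esub> x) \<otimes>\<^bsub>?Q\<^esub> (I +>\<^bsub>A\<^esub> y) = I +>\<^bsub>A\<^esub> (x \<otimes>\<^bsub>A\<^esub> y)" if "x \<in> carrier A" "y \<in> carrier A" for x y
    using that I.rcoset_mult_add by (simp add: quot_alg_sel FactRing_def)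
  have a: "(I +>\<^bsub>A\<^esub> x) \<oplus>\<^bsub>?Q\<^esub> (I +>\<^bsub>A\<^esub> y) = I +>\<^bsub>A\<^esub> (x \<oplus>\<^bsub>A\<^esub> y)" if "x \<in> carrier A" "y \<in> carrier A" for x y
    using that I.a_rcos_sum by (simp add: quot_alg_sel FactRing_def)
  note s = quot_smult_coset[OF I]
  have r: "ring (A Quot I)" by (rule I.quotient_is_ring)
  interpret Q: ring "A Quot I" by (rule r)
  have rQ: "ring ?Q"
  proof (rule ringI)
    show "abelian_group ?Q"
      by (rule abelian_groupI) (use Q.l_neg Q.a_inv_closed in \<open>auto simp: quot_alg_sel Q.a_ac\<close>)
    show "monoid ?Q" by (rule monoidI) (auto simp: quot_alg_sel Q.m_assoc)
  qed (auto simp: quot_alg_sel Q.l_distr Q.r_distr)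
  have mQ: "module K ?Q"
  proof (rule moduleI)
    show "cring K" by (rule R.is_cring)
    show "abelian_group ?Q" using rQ by (rule ring.axioms)
  qed (auto simp: cl s m a smult_l_distr smult_r_distr smult_assoc1)
  show ?thesis
    by (intro assoc_algebra.intro rQ mQ assoc_algebra_axioms.intro)
      (auto simp: cl s m smult_mult_left smult_mult_right)
qed

lemma free_monoid_monoid: "monoid (free_monoid X)"
  by (rule monoidI) (auto simp: free_monoid_def)

lemma presented_alg_assoc_algebra:
  assumes "cring K" "Rel \<subseteq> carrier (free_alg K X)"
  shows "assoc_algebra K (presented_alg K X Rel)"
proof -
  interpret mon_alg K "free_monoid X"
    by (intro mon_alg.intro assms free_monoid_monoid)
  interpret assoc_algebra K "free_alg K X" unfolding free_alg_def by (rule F_algebra)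
  show ?thesis unfolding presented_alg_def
    by (intro quot_alg_assoc_algebra genideal_ideal assms)
qed

lemma (in module) lin_span_submodule:
  assumes "S \<subseteq> carrier M"
  shows "submodule (lin_span R M S) R M"
proof (rule submoduleI)
  show "lin_span R M S \<subseteq> carrier M"
    unfolding lin_span_def using carrier_is_submodule assms by blast
qed (auto simp: lin_span_def submoduleE submodule.smult_closed
       intro: submodule.axioms(1)[THEN subgroup.one_closed, simplified])

lemma (in module) lin_span_minimal: "submodule H R M \<Longrightarrow> S \<subseteq> H \<Longrightarrow> lin_span R M S \<subseteq> H"
  unfolding lin_span_def by blast

lemma lin_span_incl: "S \<subseteq> lin_span R M S" unfolding lin_span_def by blast

lemma (in mon_alg) span_basis: "lin_span K F (basis_elt K ` carrier M) = carrier F"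
proof
  interpret A: assoc_algebra K F by (rule F_algebra)
  let ?H = "lin_span K F (basis_elt K ` carrier M)"
  have sub: "submodule ?H K F" by (rule A.lin_span_submodule) (auto simp: basis_F)
  show "?H \<subseteq> carrier F" using A.submoduleE(1)[OF sub] .
  show "carrier F \<subseteq> ?H"
  proof
    fix f assume "f \<in> carrier F"
    have "f \<in> ?H" if "finite S" "S \<subseteq> carrier M" "\<And>x. x \<notin> S \<Longrightarrow> f x = \<zero>" "\<And>x. f x \<in> carrier K" for S f
      using that
    proof (induction S arbitrary: f rule: finite_induct)
      case empty
      then have "f = \<zero>\<^bsub>F\<^esub>" by (auto simp: F_ops)
      then show ?case using submodule.axioms(1)[OF sub, THEN subgroup.one_closed] by simp
    next
      case (insert a S)
      let ?g = "f(a := \<zero>)"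
      have "?g \<in> ?H" using insert by (intro insert.IH) auto
      moreover have "f a \<odot>\<^bsub>F\<^esub> basis_elt K a \<in> ?H"
        using insert by (intro A.submoduleE(4)[OF sub] subsetD[OF lin_span_incl]) auto
      moreover have "f = ?g \<oplus>\<^bsub>F\<^esub> f a \<odot>\<^bsub>F\<^esub> basis_elt K a"
        using insert by (auto simp: F_ops basis_elt_def fun_eq_iff)
      ultimately show ?case using A.submoduleE(5)[OF sub] by metis
    qed
    from this[of "supp K f" f] \<open>f \<in> carrier F\<close> show "f \<in> ?H"
      by (auto simp: F_sel) (auto simp: supp_def)
  qed
qed


lemma (in mon_alg) span_ideal:
  assumes R: "Rel \<subseteq> carrier F"
    and L: "\<And>r x. r \<in> Rel \<Longrightarrow> x \<in> carrier M \<Longrightarrow> basis_elt K x \<otimes>\<^bsub>F\<^esub> r \<in> Rel"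
    and Rr: "\<And>r x. r \<in> Rel \<Longrightarrow> x \<in> carrier M \<Longrightarrow> r \<otimes>\<^bsub>F\<^esub> basis_elt K x \<in> Rel"
  shows "ideal (lin_span K F Rel) F"
proof -
  interpret A: assoc_algebra K F by (rule F_algebra)
  let ?N = "lin_span K F Rel"
  have sub: "submodule ?N K F" by (rule A.lin_span_submodule[OF R])
  note N = A.submoduleE[OF sub]
  have Nc: "x \<in> ?N \<Longrightarrow> x \<in> carrier F" for x using N(1) by auto
  have z: "\<zero>\<^bsub>F\<^esub> \<in> ?N" using submodule.axioms(1)[OF sub, THEN subgroup.one_closed] by simp
  let ?P = "{f \<in> carrier F. \<forall>r\<in>Rel. f \<otimes>\<^bsub>F\<^esub> r \<in> ?N \<and> r \<otimes>\<^bsub>F\<^esub> f \<in> ?N}"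
  have "submodule ?P K F"
    by (rule A.submoduleI)
      (use R N z in \<open>auto simp: A.l_distr A.r_distr A.smult_mult_left A.smult_mult_right A.l_minus A.r_minus subset_eq\<close>)
  moreover have "basis_elt K ` carrier M \<subseteq> ?P"
    using L Rr lin_span_incl[of Rel K F] by (auto simp: basis_F)
  ultimately have "carrier F \<subseteq> ?P" using A.lin_span_minimal span_basis by blast
  then have P: "f \<otimes>\<^bsub>F\<^esub> r \<in> ?N" "r \<otimes>\<^bsub>F\<^esub> f \<in> ?N" if "f \<in> carrier F" "r \<in> Rel" for f r
    using that by auto
  let ?P' = "{r \<in> carrier F. \<forall>f\<in>carrier F. f \<otimes>\<^bsub>F\<^esub> r \<in> ?N \<and> r \<otimes>\<^bsub>F\<^esub> f \<in> ?N}"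
  have "submodule ?P' K F"
    by (rule A.submoduleI)
      (use R N z in \<open>auto simp: A.l_distr A.r_distr A.smult_mult_left A.smult_mult_right A.l_minus A.r_minus subset_eq\<close>)
  moreover have "Rel \<subseteq> ?P'" using P R by auto
  ultimately have "?N \<subseteq> ?P'" by (rule A.lin_span_minimal)
  then show ?thesis
    by (intro idealI A.ring_axioms submodule.axioms(1)[OF sub]) auto
qed

lemma tensor_span_ideal:
  assumes A: "assoc_algebra K A" and B: "assoc_algebra K B"
  shows "bilinear_rels K A B \<subseteq> carrier (monoid_algebra K (A \<times>\<times> B))"
    and "ideal (lin_span K (monoid_algebra K (A \<times>\<times> B)) (bilinear_rels K A B)) (monoid_algebra K (A \<times>\<times> B))"
    and "assoc_algebra K (tensor_alg K A B)"
proof -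
  interpret A: assoc_algebra K A by fact
  interpret B: assoc_algebra K B by fact
  interpret mon_alg K "A \<times>\<times> B"
    by (intro mon_alg.intro A.R.is_cring DirProd_monoid A.monoid_axioms B.monoid_axioms)
  interpret Fa: assoc_algebra K F by (rule F_algebra)
  have car: "(a,b) \<in> carrier (A \<times>\<times> B) \<longleftrightarrow> a \<in> carrier A \<and> b \<in> carrier B" for a b
    by (simp add: DirProd_def)
  have mul: "(a,b) \<otimes>\<^bsub>A \<times>\<times> B\<^esub> (a',b') = (a \<otimes>\<^bsub>A\<^esub> a', b \<otimes>\<^bsub>B\<^esub> b')" for a b a' b'
    by (simp add: DirProd_def)
  show 1: "bilinear_rels K A B \<subseteq> carrier F"
    by (auto simp: bilinear_rels_def Let_def intro!: Fa.minus_closed Fa.smult_closed basis_F Fa.add.m_closed simp: car)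
  note dl = Fa.l_distr Fa.r_distr Fa.smult_mult_left Fa.smult_mult_right Fa.l_minus Fa.r_minus
    a_minus_def basis_mult basis_F car mul A.l_distr A.r_distr A.smult_mult_left A.smult_mult_right
    B.l_distr B.r_distr B.smult_mult_left B.smult_mult_right
  show 2: "ideal (lin_span K F (bilinear_rels K A B)) F"
  proof (rule span_ideal[OF 1])
    fix r x assume r: "r \<in> bilinear_rels K A B" and x: "x \<in> carrier (A \<times>\<times> B)"
    obtain u v where uv: "x = (u,v)" "u \<in> carrier A" "v \<in> carrier B" using x by (cases x) (auto simp: car)
    show "basis_elt K x \<otimes>\<^bsub>F\<^esub> r \<in> bilinear_rels K A B"
      using r unfolding bilinear_rels_def Let_def uv
      apply (elim UnE CollectE exE conjE)
      subgoal by (intro UnI1 CollectI) (use uv in \<open>simp add: dl; blast intro: A.m_closed B.m_closed\<close>)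
      subgoal by (rule UnI1, rule UnI1, rule UnI2) (use uv in \<open>simp add: dl; blast intro: A.m_closed B.m_closed\<close>)
      subgoal by (rule UnI1, rule UnI2) (use uv in \<open>simp add: dl; blast intro: A.m_closed B.m_closed\<close>)
      subgoal by (rule UnI2) (use uv in \<open>simp add: dl; blast intro: A.m_closed B.m_closed\<close>)
      done
    show "r \<otimes>\<^bsub>F\<^esub> basis_elt K x \<in> bilinear_rels K A B"
      using r unfolding bilinear_rels_def Let_def uv
      apply (elim UnE CollectE exE conjE)
      subgoal by (intro UnI1 CollectI) (use uv in \<open>simp add: dl; blast intro: A.m_closed B.m_closed\<close>)
      subgoal by (rule UnI1, rule UnI1, rule UnI2) (use uv in \<open>simp add: dl; blast intro: A.m_closed B.m_closed\<close>)
      subgoal by (rule UnI1, rule UnI2) (use uv in \<open>simp add: dl; blast intro: A.m_closed B.m_closed\<close>)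
      subgoal by (rule UnI2) (use uv in \<open>simp add: dl; blast intro: A.m_closed B.m_closed\<close>)
      done
  qed
  show "assoc_algebra K (tensor_alg K A B)"
    unfolding tensor_alg_def Let_def by (rule Fa.quot_alg_assoc_algebra[OF 2])
qed

lemma quantum_algebras:
  assumes "field K" "q \<in> carrier K" "q \<noteq> \<zero>\<^bsub>K\<^esub>"
  shows "assoc_algebra K (qmat K q m n)" "assoc_algebra K (qaff K q n)"
    "ideal (qminor_ideal K q m n) (qmat K q m n)"
proof -
  interpret K: field K by fact
  have idx: "(i,j) \<in> qmat_index m n \<longleftrightarrow> i \<ge> 1 \<and> i \<le> m \<and> j \<ge> 1 \<and> j \<le> n" for i j
    by (auto simp: qmat_index_def)
  have qi: "inv\<^bsub>K\<^esub> q \<in> carrier K" using assms by (simp add: K.field_Units)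
  interpret FM: assoc_algebra K "free_alg K (qmat_index m n)"
    unfolding free_alg_def by (intro mon_alg.F_algebra mon_alg.intro K.is_cring free_monoid_monoid)
  interpret FY: assoc_algebra K "free_alg K {1..n}"
    unfolding free_alg_def by (intro mon_alg.F_algebra mon_alg.intro K.is_cring free_monoid_monoid)
  have g1: "free_gen K x \<in> carrier (free_alg K (qmat_index m n))" if "x \<in> qmat_index m n" for x
    using that unfolding free_alg_def free_gen_def
    by (intro mon_alg.basis_F mon_alg.intro K.is_cring free_monoid_monoid) (auto simp: free_monoid_def)
  have g2: "free_gen K x \<in> carrier (free_alg K {1..n})" if "x \<in> {1..n}" for x
    using that unfolding free_alg_def free_gen_def
    by (intro mon_alg.basis_F mon_alg.intro K.is_cring free_monoid_monoid) (auto simp: free_monoid_def)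
  have r1: "qmat_rels K q m n \<subseteq> carrier (free_alg K (qmat_index m n))"
    unfolding qmat_rels_def Let_def
    by (auto intro!: FM.minus_closed FM.smult_closed FM.m_closed g1 K.minus_closed assms qi simp: idx)
  have r2: "qaff_rels K q n \<subseteq> carrier (free_alg K {1..n})"
    unfolding qaff_rels_def Let_def
    by (auto simp del: One_nat_def intro!: FY.minus_closed FY.smult_closed FY.m_closed g2 assms)
  show Q: "assoc_algebra K (qmat K q m n)" and "assoc_algebra K (qaff K q n)"
    unfolding qmat_def qaff_def by (intro presented_alg_assoc_algebra K.is_cring r1 r2)+
  interpret Q: assoc_algebra K "qmat K q m n" by (rule Q)
  have I: "ideal (Idl\<^bsub>free_alg K (qmat_index m n)\<^esub> qmat_rels K q m n) (free_alg K (qmat_index m n))"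
    by (intro FM.genideal_ideal r1)
  have g: "qmat_gen K q m n i j \<in> carrier (qmat K q m n)" if "(i,j) \<in> qmat_index m n" for i j
    using g1[OF that] unfolding qmat_gen_def presented_gen_def qmat_def presented_alg_def quot_alg_sel
    by (auto simp: FactRing_def A_RCOSETS_def')
  show "ideal (qminor_ideal K q m n) (qmat K q m n)"
    unfolding qminor_ideal_def
    by (rule Q.genideal_ideal)
       (auto simp: qminors2_def Let_def intro!: Q.minus_closed Q.smult_closed Q.m_closed g assms simp: idx)
qed

end

theory Submission
  imports Defs "HOL-Library.Multiset_Order" "HOL-Library.Product_Lexorder" "HOL-Library.Product_Plus"
begin

text \<open>
  The embedding sends \<open>X\<^sub>i\<^sub>j\<close> to \<open>y\<^sub>i \<otimes> z\<^sub>j\<close>. Modulo the quantum minors, the row indices and the column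
  indices of a word in the \<open>X\<^sub>i\<^sub>j\<close> can be sorted independently, each exchange of neighbours costing a
  factor \<open>q\<close>; so a word \<open>w\<close> equals \<open>q ^ \<nu> w\<close> times a normal form that depends only on the content of
  \<open>w\<close>, the pair of multisets of its row and column indices, where \<open>\<nu> w\<close> counts ascents. An element
  \<open>f\<close> of the free algebra therefore vanishes in the quotient as soon as
  \<open>coef e f = (\<Sum>w. f w * q ^ \<nu> w)\<close>, summed over the words of content \<open>e\<close>, is zero for every \<open>e\<close>.
  Conversely \<open>coef e\<close> factors through the tensor product, being the product of the analogous
  functionals on the two quantum affine spaces. Hence both the minor ideal and the kernel of the
  embedding correspond to the common kernel of all \<open>coef e\<close>, which is completely prime because
  \<open>\<nu>\<close> is additive up to a bilinear term and contents form an ordered cancellative monoid.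
\<close>

subsection \<open>Algebra homomorphisms\<close>

lemma (in module) minus_eq_zero_iff:
  "x \<in> carrier M \<Longrightarrow> y \<in> carrier M \<Longrightarrow> x \<ominus>\<^bsub>M\<^esub> y = \<zero>\<^bsub>M\<^esub> \<longleftrightarrow> x = y"
  by (metis M.minus_eq M.minus_equality M.minus_minus M.r_neg M.a_inv_closed)

text \<open>With \<open>x\<close> for the product of \<open>x i s\<close> and \<open>x l j\<close>,
  and \<open>y\<close> for that of \<open>x l s\<close> and \<open>x i j\<close>, the left side is
  the fourth quantum matrix relation after a minor has replaced its leading product by
  \<open>q\<close> times \<open>x\<close>. Cancelling the terms in \<open>q\<close> leaves
  \<open>y\<close> as \<open>inv q\<close> times \<open>x\<close>.\<close>

lemma (in module) q_commutator_iff: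
  assumes "field R" "q \<in> carrier R" "q \<noteq> \<zero>\<^bsub>R\<^esub>" "x \<in> carrier M" "y \<in> carrier M"
  shows "q \<odot>\<^bsub>M\<^esub> x \<ominus>\<^bsub>M\<^esub> y = (q \<ominus>\<^bsub>R\<^esub> inv\<^bsub>R\<^esub> q) \<odot>\<^bsub>M\<^esub> x \<longleftrightarrow> x = q \<odot>\<^bsub>M\<^esub> y"
proof -
  interpret K: field R by fact
  have qU: "q \<in> Units R" using assms by (simp add: K.field_Units)
  then have qi: "inv\<^bsub>R\<^esub> q \<in> carrier R" by simp
  have "(q \<ominus>\<^bsub>R\<^esub> inv\<^bsub>R\<^esub> q) \<odot>\<^bsub>M\<^esub> x = q \<odot>\<^bsub>M\<^esub> x \<ominus>\<^bsub>M\<^esub> inv\<^bsub>R\<^esub> q \<odot>\<^bsub>M\<^esub> x"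
    using assms qi by (simp add: a_minus_def smult_l_distr smult_l_minus)
  then have "q \<odot>\<^bsub>M\<^esub> x \<ominus>\<^bsub>M\<^esub> y = (q \<ominus>\<^bsub>R\<^esub> inv\<^bsub>R\<^esub> q) \<odot>\<^bsub>M\<^esub> x \<longleftrightarrow> y = inv\<^bsub>R\<^esub> q \<odot>\<^bsub>M\<^esub> x"
    using assms qi by (metis M.r_neg1 M.minus_minus M.a_inv_closed M.minus_eq smult_closed)
  also have "\<dots> \<longleftrightarrow> x = q \<odot>\<^bsub>M\<^esub> y"
  proof
    assume "y = inv\<^bsub>R\<^esub> q \<odot>\<^bsub>M\<^esub> x"
    then show "x = q \<odot>\<^bsub>M\<^esub> y" using assms qi qU by (simp flip: smult_assoc1)
  next
    assume "x = q \<odot>\<^bsub>M\<^esub> y"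
    then show "y = inv\<^bsub>R\<^esub> q \<odot>\<^bsub>M\<^esub> x" using assms qi qU by (simp flip: smult_assoc1)
  qed
  finally show ?thesis .
qed

lemma (in module) finsum_smult_rdistr:
  assumes "finite A" "\<And>i. i \<in> A \<Longrightarrow> f i \<in> carrier R" "x \<in> carrier M"
  shows "(\<Oplus>\<^bsub>R\<^esub>i\<in>A. f i) \<odot>\<^bsub>M\<^esub> x = (\<Oplus>\<^bsub>M\<^esub>i\<in>A. f i \<odot>\<^bsub>M\<^esub> x)"
  using assms(1,2)
  by (induction A rule: finite_induct)
    (simp_all add: assms(3) smult_l_distr R.finsum_insert M.finsum_insert Pi_def R.finsum_closed)

locale algebra_hom = A: assoc_algebra K A + B: assoc_algebra K B
  for K (structure) and A (structure) and B (structure) +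
  fixes h
  assumes hom: "h \<in> alg_hom K A B"
begin

lemma closed [simp]: "x \<in> carrier A \<Longrightarrow> h x \<in> carrier B"
  and mult [simp]: "x \<in> carrier A \<Longrightarrow> y \<in> carrier A \<Longrightarrow> h (x \<otimes>\<^bsub>A\<^esub> y) = h x \<otimes>\<^bsub>B\<^esub> h y"
  and add [simp]: "x \<in> carrier A \<Longrightarrow> y \<in> carrier A \<Longrightarrow> h (x \<oplus>\<^bsub>A\<^esub> y) = h x \<oplus>\<^bsub>B\<^esub> h y"
  and one [simp]: "h \<one>\<^bsub>A\<^esub> = \<one>\<^bsub>B\<^esub>"
  and smult [simp]: "c \<in> carrier K \<Longrightarrow> x \<in> carrier A \<Longrightarrow> h (c \<odot>\<^bsub>A\<^esub> x) = c \<odot>\<^bsub>B\<^esub> h x"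
  using hom by (auto simp: alg_hom_def ring_hom_def)

sublocale ring_hom_ring A B h
  by unfold_locales (use hom in \<open>simp add: alg_hom_def\<close>)

lemma minus: "x \<in> carrier A \<Longrightarrow> y \<in> carrier A \<Longrightarrow> h (x \<ominus>\<^bsub>A\<^esub> y) = h x \<ominus>\<^bsub>B\<^esub> h y"
  by (simp only: a_minus_def add hom_a_inv A.a_inv_closed)

lemma genideal_kernel:
  assumes "S \<subseteq> carrier A" "\<And>s. s \<in> S \<Longrightarrow> h s = \<zero>\<^bsub>B\<^esub>" "x \<in> Idl\<^bsub>A\<^esub> S"
  shows "h x = \<zero>\<^bsub>B\<^esub>"
proof -
  have "S \<subseteq> a_kernel A B h" unfolding a_kernel_def' using assms(1,2) by blast
  then have "Idl\<^bsub>A\<^esub> S \<subseteq> a_kernel A B h" by (rule A.genideal_minimal[OF kernel_is_ideal])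
  then show ?thesis using assms(3) unfolding a_kernel_def' by blast
qed

lemma image_subalgebra: "is_subalgebra K (h ` carrier A) B"
  unfolding is_subalgebra_def
proof
  show "subring (h ` carrier A) B"
  proof (rule B.subringI)
    show "\<one>\<^bsub>B\<^esub> \<in> h ` carrier A" using one by (metis A.one_closed imageI)
  qed (auto simp: image_iff, (metis A.a_inv_closed hom_a_inv A.m_closed mult A.a_closed add)+)
  show "submodule (h ` carrier A) K B"
  proof (rule B.submoduleI)
    show "\<zero>\<^bsub>B\<^esub> \<in> h ` carrier A" using hom_zero by (metis A.zero_closed imageI)
  qed (auto simp: image_iff, (metis A.a_inv_closed hom_a_inv A.smult_closed smult A.a_closed add)+)
qed

end

lemma algebra_hom_comp:
  assumes "algebra_hom K A B f" "algebra_hom K B C g"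
  shows "algebra_hom K A C (\<lambda>x. g (f x))"
proof -
  interpret f: algebra_hom K A B f by fact
  interpret g: algebra_hom K B C g by fact
  show ?thesis
    by (intro algebra_hom.intro algebra_hom_axioms.intro f.A.assoc_algebra_axioms g.B.assoc_algebra_axioms)
      (auto simp: alg_hom_def intro!: ring_hom_memI)
qed

section \<open>Quotient algebras and induced maps\<close>

lemma (in assoc_algebra) coset_hom:
  assumes "ideal I A"
  shows "(\<lambda>x. I +>\<^bsub>A\<^esub> x) \<in> alg_hom K A (quot_alg A I)"
  using ideal.rcos_ring_hom[OF assms] quot_smult_coset[OF assms]
  by (auto simp: alg_hom_def ring_hom_def quot_alg_sel)

lemma (in assoc_algebra) coset_algebra_hom:
  assumes "ideal I A"
  shows "algebra_hom K A (quot_alg A I) (\<lambda>x. I +>\<^bsub>A\<^esub> x)"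
  by (intro algebra_hom.intro algebra_hom_axioms.intro assoc_algebra_axioms
      quot_alg_assoc_algebra coset_hom assms)

lemma (in assoc_algebra) carrier_quot_alg:
  "carrier (quot_alg A I) = (\<lambda>x. I +>\<^bsub>A\<^esub> x) ` carrier A"
  by (auto simp: quot_alg_sel FactRing_def A_RCOSETS_def')

lemma (in assoc_algebra) coset_eq_zero_iff:
  assumes "ideal I A" "x \<in> carrier A"
  shows "I +>\<^bsub>A\<^esub> x = \<zero>\<^bsub>quot_alg A I\<^esub> \<longleftrightarrow> x \<in> I"
proof -
  interpret I: ideal I A by fact
  show ?thesis
    using I.a_rcos_const I.a_rcos_self[OF assms(2)] by (auto simp: quot_alg_sel FactRing_def)
qed

text \<open>The map induced on cosets, meaningful when \<open>h\<close> is constant on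
  \<open>X\<close>. It is kept free of algebraic structure so that it serves both homomorphisms and
  the linear functionals \<open>coef e\<close>.\<close>

definition quot_lift :: "('a \<Rightarrow> 'b) \<Rightarrow> 'a set \<Rightarrow> 'b"
  where "quot_lift h X = the_elem (h ` X)"

lemma (in ideal) quot_lift_coset_eq:
  assumes "\<And>i. i \<in> I \<Longrightarrow> h (i \<oplus> x) = h x" "x \<in> carrier R"
  shows "quot_lift h (I +> x) = h x"
proof -
  have "h ` (I +> x) = {h x}"
    using assms(1) a_rcos_self[OF assms(2)] by (auto simp: a_r_coset_def')
  then show ?thesis by (simp add: quot_lift_def)
qed

context algebra_hom
begin

lemma quot_lift_coset:
  assumes "ideal I A" "\<And>i. i \<in> I \<Longrightarrow> h i = \<zero>\<^bsub>B\<^esub>" "x \<in> carrier A"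
  shows "quot_lift h (I +>\<^bsub>A\<^esub> x) = h x"
  using assms by (intro ideal.quot_lift_coset_eq) (auto simp: ideal.Icarr)

lemma quot_lift_algebra_hom:
  assumes I: "ideal I A" and 0: "\<And>i. i \<in> I \<Longrightarrow> h i = \<zero>\<^bsub>B\<^esub>"
  shows "algebra_hom K (quot_alg A I) B (quot_lift h)"
proof -
  interpret p: algebra_hom K A "quot_alg A I" "\<lambda>x. I +>\<^bsub>A\<^esub> x"
    by (rule A.coset_algebra_hom[OF I])
  have "quot_lift h \<in> alg_hom K (quot_alg A I) B"
    by (auto simp: alg_hom_def A.carrier_quot_alg quot_lift_coset[OF I 0]
        simp flip: p.mult p.add p.smult p.one intro!: ring_hom_memI)
  then show ?thesis
    by (intro algebra_hom.intro algebra_hom_axioms.intro p.B.assoc_algebra_axioms B.assoc_algebra_axioms)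
qed

end

section \<open>Linear and multiplicative extension from the monoid to its algebra\<close>

context mon_alg
begin

text \<open>Induction principle: the monoid elements span, so a property preserved by the module
  operations need only be checked on them.\<close>

lemma submodule_containing_basis:
  assumes "submodule H K F" "\<And>x. x \<in> carrier M \<Longrightarrow> basis_elt K x \<in> H" "f \<in> carrier F"
  shows "f \<in> H"
proof -
  interpret A: assoc_algebra K F by (rule F_algebra)
  have "lin_span K F (basis_elt K ` carrier M) \<subseteq> H"
    using assms by (intro A.lin_span_minimal) auto
  then show ?thesis using assms by (auto simp: span_basis)
qed

end

locale mon_alg_ext = mon_alg K M + B: assoc_algebra K B
  for K (structure) and M (structure) and B (structure) +
  fixes p
  assumes p_closed [simp]: "x \<in> carrier M \<Longrightarrow> p x \<in> carrier B"
begin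

sublocale F: assoc_algebra K F by (rule F_algebra)

definition lin_ext where "lin_ext f = (\<Oplus>\<^bsub>B\<^esub>x\<in>supp K f. f x \<odot>\<^bsub>B\<^esub> p x)"

lemma lin_ext_superset:
  assumes "f \<in> carrier F" "finite S" "supp K f \<subseteq> S" "S \<subseteq> carrier M"
  shows "lin_ext f = (\<Oplus>\<^bsub>B\<^esub>x\<in>S. f x \<odot>\<^bsub>B\<^esub> p x)"
  unfolding lin_ext_def
  by (rule B.add.finprod_mono_neutral_cong_left) (use assms F_sel in \<open>auto simp: supp_def subset_eq\<close>)

lemma lin_ext_closed [simp]: "f \<in> carrier F \<Longrightarrow> lin_ext f \<in> carrier B"
  unfolding lin_ext_def by (intro B.finsum_closed) (auto simp: F_sel)

lemma lin_ext_basis: "x \<in> carrier M \<Longrightarrow> lin_ext (basis_elt K x) = p x"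
  by (subst lin_ext_superset[of _ "{x}"]) (auto simp: basis_F supp_def, auto simp: basis_elt_def split: if_splits)

lemma lin_ext_add:
  assumes "f \<in> carrier F" "g \<in> carrier F"
  shows "lin_ext (f \<oplus>\<^bsub>F\<^esub> g) = lin_ext f \<oplus>\<^bsub>B\<^esub> lin_ext g"
proof -
  let ?S = "supp K f \<union> supp K g"
  have S: "finite ?S" "?S \<subseteq> carrier M" "\<And>x. x \<in> ?S \<Longrightarrow> p x \<in> carrier B" using assms F_sel by auto
  have "supp K (f \<oplus>\<^bsub>F\<^esub> g) \<subseteq> ?S" using assms by (auto simp: F_ops supp_def)
  then have "lin_ext (f \<oplus>\<^bsub>F\<^esub> g) = (\<Oplus>\<^bsub>B\<^esub>x\<in>?S. (f \<oplus>\<^bsub>F\<^esub> g) x \<odot>\<^bsub>B\<^esub> p x)"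
    using assms S by (intro lin_ext_superset) auto
  also have "\<dots> = (\<Oplus>\<^bsub>B\<^esub>x\<in>?S. f x \<odot>\<^bsub>B\<^esub> p x \<oplus>\<^bsub>B\<^esub> g x \<odot>\<^bsub>B\<^esub> p x)"
    using assms S by (intro B.finsum_cong') (auto simp: F_ops F_sel B.smult_l_distr)
  also have "\<dots> = (\<Oplus>\<^bsub>B\<^esub>x\<in>?S. f x \<odot>\<^bsub>B\<^esub> p x) \<oplus>\<^bsub>B\<^esub> (\<Oplus>\<^bsub>B\<^esub>x\<in>?S. g x \<odot>\<^bsub>B\<^esub> p x)"
    using assms S by (intro B.finsum_addf) (auto simp: F_sel)
  also have "\<dots> = lin_ext f \<oplus>\<^bsub>B\<^esub> lin_ext g"
    using assms S by (simp add: lin_ext_superset[of _ ?S])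
  finally show ?thesis .
qed

lemma lin_ext_smult:
  assumes "f \<in> carrier F" "c \<in> carrier K"
  shows "lin_ext (c \<odot>\<^bsub>F\<^esub> f) = c \<odot>\<^bsub>B\<^esub> lin_ext f"
proof -
  let ?S = "supp K f"
  have S: "finite ?S" "?S \<subseteq> carrier M" "\<And>x. x \<in> ?S \<Longrightarrow> p x \<in> carrier B" using assms F_sel by auto
  have "supp K (c \<odot>\<^bsub>F\<^esub> f) \<subseteq> ?S" using assms by (auto simp: F_ops supp_def)
  then have "lin_ext (c \<odot>\<^bsub>F\<^esub> f) = (\<Oplus>\<^bsub>B\<^esub>x\<in>?S. (c \<odot>\<^bsub>F\<^esub> f) x \<odot>\<^bsub>B\<^esub> p x)"
    using assms S by (intro lin_ext_superset) auto
  also have "\<dots> = (\<Oplus>\<^bsub>B\<^esub>x\<in>?S. c \<odot>\<^bsub>B\<^esub> (f x \<odot>\<^bsub>B\<^esub> p x))"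
    using assms S by (intro B.finsum_cong') (auto simp: F_ops F_sel B.smult_assoc1)
  also have "\<dots> = c \<odot>\<^bsub>B\<^esub> lin_ext f"
    unfolding lin_ext_def using assms S by (intro B.finsum_smult_ldistr[symmetric]) (auto simp: F_sel)
  finally show ?thesis .
qed

lemma lin_ext_zero: "lin_ext \<zero>\<^bsub>F\<^esub> = \<zero>\<^bsub>B\<^esub>"
  by (simp add: lin_ext_def supp_def F_ops)

lemma lin_ext_a_inv:
  assumes "f \<in> carrier F"
  shows "lin_ext (\<ominus>\<^bsub>F\<^esub> f) = \<ominus>\<^bsub>B\<^esub> lin_ext f"
  using assms lin_ext_add[of "\<ominus>\<^bsub>F\<^esub> f" f]
  by (intro B.minus_equality[symmetric]) (simp_all add: F.l_neg lin_ext_zero)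

text \<open>Multiplicativity is linear in each factor: it is propagated from the basis first in the
  right factor, with a basis element on the left, and then in the left factor.\<close>

lemma lin_ext_algebra_hom:
  assumes p_mult: "\<And>x y. x \<in> carrier M \<Longrightarrow> y \<in> carrier M \<Longrightarrow> p (x \<otimes>\<^bsub>M\<^esub> y) = p x \<otimes>\<^bsub>B\<^esub> p y"
    and p_one: "p \<one>\<^bsub>M\<^esub> = \<one>\<^bsub>B\<^esub>"
  shows "algebra_hom K F B lin_ext"
proof -
  let ?h = "lin_ext"
  note hs = lin_ext_add lin_ext_smult lin_ext_zero lin_ext_a_inv lin_ext_basis basis_F
    F.l_distr F.r_distr F.smult_mult_left F.smult_mult_right F.l_minus F.r_minus
    B.l_distr B.r_distr B.smult_mult_left B.smult_mult_right B.l_minus B.r_minus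
  have 1: "?h (basis_elt K x \<otimes>\<^bsub>F\<^esub> g) = p x \<otimes>\<^bsub>B\<^esub> ?h g" if x: "x \<in> carrier M" and g: "g \<in> carrier F" for x g
  proof -
    let ?H = "{g \<in> carrier F. ?h (basis_elt K x \<otimes>\<^bsub>F\<^esub> g) = p x \<otimes>\<^bsub>B\<^esub> ?h g}"
    have "submodule ?H K F" using x by (intro F.submoduleI) (auto simp: hs)
    then have "g \<in> ?H"
      by (rule submodule_containing_basis) (use x g in \<open>auto simp: hs basis_mult p_mult\<close>)
    then show ?thesis by simp
  qed
  have 2: "?h (f \<otimes>\<^bsub>F\<^esub> g) = ?h f \<otimes>\<^bsub>B\<^esub> ?h g" if f: "f \<in> carrier F" and g: "g \<in> carrier F" for f g
  proof -
    let ?H = "{f \<in> carrier F. ?h (f \<otimes>\<^bsub>F\<^esub> g) = ?h f \<otimes>\<^bsub>B\<^esub> ?h g}"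
    have "submodule ?H K F" using g by (intro F.submoduleI) (auto simp: hs)
    then have "f \<in> ?H"
      by (rule submodule_containing_basis) (use f g in \<open>auto simp: 1 hs\<close>)
    then show ?thesis by simp
  qed
  show ?thesis
    by (intro algebra_hom.intro algebra_hom_axioms.intro F.assoc_algebra_axioms B.assoc_algebra_axioms)
      (auto simp: alg_hom_def lin_ext_smult lin_ext_add 2 F_ops(4) lin_ext_basis p_one intro!: ring_hom_memI)
qed

end

subsection \<open>Words weighted by powers of \<open>q\<close>\<close>

text \<open>A homomorphism and the linear extension of its own values on the monoid are both linear
  and coincide on the basis.\<close>

lemma (in mon_alg) hom_eq_finsum:
  assumes "algebra_hom K F B h" "f \<in> carrier F"
  shows "h f = (\<Oplus>\<^bsub>B\<^esub>x\<in>supp K f. f x \<odot>\<^bsub>B\<^esub> h (basis_elt K x))"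
proof -
  interpret h: algebra_hom K F B h by fact
  interpret e: mon_alg_ext K M B "\<lambda>x. h (basis_elt K x)"
    by unfold_locales (simp add: basis_F)
  let ?H = "{f \<in> carrier F. h f = e.lin_ext f}"
  have "submodule ?H K F"
    by (intro h.A.submoduleI)
      (auto simp: e.lin_ext_add e.lin_ext_smult e.lin_ext_a_inv e.lin_ext_zero)
  then have "f \<in> ?H"
    by (rule submodule_containing_basis) (use assms in \<open>auto simp: e.lin_ext_basis basis_F\<close>)
  then show ?thesis by (simp add: e.lin_ext_def)
qed

context mon_alg
begin

lemma pair_zero: "f \<in> carrier F \<Longrightarrow> pair f (\<lambda>x. \<zero>) = \<zero>"
  unfolding pair_def by (subst finsum_cong'[where g = "\<lambda>x. \<zero>"]) (auto simp: F_sel)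

lemma pair_zero_elt: "pair \<zero>\<^bsub>F\<^esub> \<phi> = \<zero>"
  by (simp add: pair_def supp_def F_ops)

lemma pair_a_inv:
  assumes "f \<in> carrier F" "\<And>x. x \<in> carrier M \<Longrightarrow> \<phi> x \<in> carrier K"
  shows "pair (\<ominus>\<^bsub>F\<^esub> f) \<phi> = \<ominus> pair f \<phi>"
proof -
  interpret F: assoc_algebra K F by (rule F_algebra)
  show ?thesis
    using assms pair_add[of "\<ominus>\<^bsub>F\<^esub> f" f \<phi>]
    by (intro minus_equality[symmetric]) (simp_all add: F.l_neg pair_zero_elt)
qed

lemma pair_kernel_submodule:
  assumes "\<And>x. x \<in> carrier M \<Longrightarrow> \<phi> x \<in> carrier K"
  shows "submodule {f \<in> carrier F. pair f \<phi> = \<zero>} K F"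
proof -
  interpret F: assoc_algebra K F by (rule F_algebra)
  show ?thesis
    using assms by (intro F.submoduleI) (auto simp: pair_add pair_smult pair_a_inv pair_zero_elt)
qed

end

text \<open>\<open>c\<close> is the content of a word and \<open>\<nu>\<close> its exponent of
  \<open>q\<close>. The correction \<open>b\<close> depends on contents only, which makes the
  functionals below behave well under products. The instances are single-index words with
  \<open>mset\<close> and matrix words with \<open>matrix_content\<close>.\<close>

locale weighted_words = field K for K (structure) +
  fixes X :: "'x set" and c :: "'x list \<Rightarrow> 'g :: {cancel_comm_monoid_add, linorder}"
    and \<nu> :: "'x list \<Rightarrow> nat" and b :: "'g \<Rightarrow> 'g \<Rightarrow> nat" and q
  assumes q [simp]: "q \<in> carrier K" "q \<noteq> \<zero>"
    and c_append: "c (u @ v) = c u + c v"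
    and \<nu>_append: "\<nu> (u @ v) = \<nu> u + \<nu> v + b (c u) (c v)"
    and add_less: "x < y \<Longrightarrow> x + z < y + (z :: 'g)"
begin

sublocale mon_alg K "free_monoid X"
  by (intro mon_alg.intro is_cring free_monoid_monoid)

sublocale F: assoc_algebra K F by (rule F_algebra)

lemma free_monoid_sel [simp]:
  "carrier (free_monoid X) = lists X" "u \<otimes>\<^bsub>free_monoid X\<^esub> v = u @ v" "\<one>\<^bsub>free_monoid X\<^esub> = []"
  by (simp_all add: free_monoid_def)

lemma q_pow_nonzero [simp]: "q [^] (n::nat) \<noteq> \<zero>"
  by (induction n) (simp_all add: integral_iff)

definition weight :: "'g \<Rightarrow> 'x list \<Rightarrow> _"
  where "weight e w = (if c w = e then q [^] \<nu> w else \<zero>)"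

definition coef where "coef e f = pair f (weight e)"

lemma weight_closed [simp]: "weight e w \<in> carrier K"
  by (simp add: weight_def)

lemma coef_closed [simp]: "f \<in> carrier F \<Longrightarrow> coef e f \<in> carrier K"
  by (simp add: coef_def)

text \<open>Subtraction in a cancellative monoid has its expected meaning only on actual sums, so
  the condition tests whether \<open>c u\<close> is a summand of \<open>e\<close>. For fixed
  \<open>u\<close> the weight becomes a constant multiple of a weight of \<open>v\<close>, so
  pairing with it reduces to \<open>coef (e - c u)\<close>.\<close>

lemma weight_append_left:
  "weight e (u @ v) =
    (if e = c u + (e - c u) then q [^] (\<nu> u + b (c u) (e - c u)) else \<zero>) \<otimes> weight (e - c u) v"
proof -
  have "c u + c v = e \<longleftrightarrow> e = c u + (e - c u) \<and> c v = e - c u" by (metis add_diff_cancel_left')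
  then show ?thesis
    by (auto simp: weight_def c_append \<nu>_append nat_pow_mult ac_simps)
qed

lemma weight_append_right:
  "weight e (u @ v) =
    (if e = c v + (e - c v) then q [^] (\<nu> v + b (e - c v) (c v)) else \<zero>) \<otimes> weight (e - c v) u"
proof -
  have "c u + c v = e \<longleftrightarrow> e = c v + (e - c v) \<and> c u = e - c v"
    by (metis add_diff_cancel_right' add.commute)
  then show ?thesis
    by (auto simp: weight_def c_append \<nu>_append nat_pow_mult ac_simps)
qed

definition null_ideal where "null_ideal = {f \<in> carrier F. \<forall>e. coef e f = \<zero>}"

lemma coef_mult:
  assumes "f \<in> carrier F" "g \<in> carrier F"
  shows "coef e (f \<otimes>\<^bsub>F\<^esub> g) = pair f (\<lambda>u. pair g (\<lambda>v. weight e (u @ v)))"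
  unfolding coef_def using assms pair_finsum[of f g "weight e"] by simp

lemma coef_add: "f \<in> carrier F \<Longrightarrow> g \<in> carrier F \<Longrightarrow> coef e (f \<oplus>\<^bsub>F\<^esub> g) = coef e f \<oplus> coef e g"
  by (simp add: coef_def pair_add)

lemma coef_smult: "f \<in> carrier F \<Longrightarrow> k \<in> carrier K \<Longrightarrow> coef e (k \<odot>\<^bsub>F\<^esub> f) = k \<otimes> coef e f"
  by (simp add: coef_def pair_smult)

lemma coef_zero: "coef e \<zero>\<^bsub>F\<^esub> = \<zero>"
  by (simp add: coef_def pair_zero_elt)

lemma coef_a_inv: "f \<in> carrier F \<Longrightarrow> coef e (\<ominus>\<^bsub>F\<^esub> f) = \<ominus> coef e f"
  by (simp add: coef_def pair_a_inv)

lemma coef_basis: "w \<in> lists X \<Longrightarrow> coef e (basis_elt K w) = weight e w"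
  unfolding coef_def by (rule pair_basis) auto

lemma null_submodule: "submodule null_ideal K F"
  by (intro F.submoduleI) (auto simp: null_ideal_def coef_add coef_smult coef_zero coef_a_inv)

text \<open>By the factorisations of \<open>weight\<close>, each coefficient of a product with a
  fixed word is a multiple of one coefficient of the other factor.\<close>

lemma null_ideal: "ideal null_ideal F"
proof (rule idealI)
  show "ring F" by (rule F.ring_axioms)
  show "subgroup null_ideal (add_monoid F)" using null_submodule by (rule submodule.axioms)
  fix g f assume g: "g \<in> null_ideal" and f: "f \<in> carrier F"
  have gF: "g \<in> carrier F" and g0: "coef e g = \<zero>" for e using g by (auto simp: null_ideal_def)
  have "coef e (f \<otimes>\<^bsub>F\<^esub> g) = \<zero>" for e
  proof -
    have "pair g (\<lambda>v. weight e (u @ v)) = \<zero>" for u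
      using g0 gF by (simp add: weight_append_left pair_smult2 flip: coef_def)
    then show ?thesis using f gF by (simp add: coef_mult pair_zero)
  qed
  then show "f \<otimes>\<^bsub>F\<^esub> g \<in> null_ideal" using f gF by (simp add: null_ideal_def)
  \<comment> \<open>\<open>coef_mult\<close> has the left factor outermost, so multiplication on the
    right is checked for a single word \<open>v\<close> and extended linearly.\<close>
  let ?H = "{f \<in> carrier F. g \<otimes>\<^bsub>F\<^esub> f \<in> null_ideal}"
  have "submodule ?H K F"
    using F.submoduleE[OF null_submodule] gF null_submodule[THEN submodule.axioms(1), THEN subgroup.one_closed]
    by (intro F.submoduleI) (auto simp: F.r_distr F.smult_mult_right F.r_minus)
  then have "f \<in> ?H"
  proof (rule submodule_containing_basis)
    fix v assume v: "v \<in> carrier (free_monoid X)"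
    have "coef e (g \<otimes>\<^bsub>F\<^esub> basis_elt K v) = \<zero>" for e
      using v g0 gF
      by (simp add: coef_mult basis_F pair_basis) (simp add: weight_append_right pair_smult2 flip: coef_def)
    then show "basis_elt K v \<in> ?H" using v gF by (simp add: null_ideal_def basis_F)
  qed (use f in auto)
  then show "g \<otimes>\<^bsub>F\<^esub> f \<in> null_ideal" by simp
qed

text \<open>Regrouping the expansion of \<open>h f\<close> by content turns it into the sum of
  \<open>coef a f\<close> times \<open>V a\<close>, where every term vanishes.\<close>

lemma hom_null:
  assumes h: "algebra_hom K F B h" and f: "f \<in> null_ideal"
    and V: "\<And>w. w \<in> lists X \<Longrightarrow> V (c w) \<in> carrier B"
      "\<And>w. w \<in> lists X \<Longrightarrow> h (basis_elt K w) = q [^] \<nu> w \<odot>\<^bsub>B\<^esub> V (c w)"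
  shows "h f = \<zero>\<^bsub>B\<^esub>"
proof -
  interpret h: algebra_hom K F B h by fact
  have fF: "f \<in> carrier F" and f0: "coef e f = \<zero>" for e using f by (auto simp: null_ideal_def)
  let ?S = "supp K f"
  have S: "finite ?S" "?S \<subseteq> lists X" using fF F_sel by auto
  have Vc: "V a \<in> carrier B" if "a \<in> c ` ?S" for a using that V S by auto
  have "h f = (\<Oplus>\<^bsub>B\<^esub>w\<in>?S. f w \<odot>\<^bsub>B\<^esub> h (basis_elt K w))" by (rule hom_eq_finsum[OF h fF])
  \<comment> \<open>Each word is spread over all occurring contents, of which only its own
    contributes; then the two sums can be exchanged.\<close>
  also have "\<dots> = (\<Oplus>\<^bsub>B\<^esub>w\<in>?S. \<Oplus>\<^bsub>B\<^esub>a\<in>c ` ?S. (f w \<otimes> weight a w) \<odot>\<^bsub>B\<^esub> V a)"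
  proof (intro h.B.finsum_cong' refl)
    fix w assume w: "w \<in> ?S"
    have "(\<Oplus>\<^bsub>B\<^esub>a\<in>c ` ?S. (f w \<otimes> weight a w) \<odot>\<^bsub>B\<^esub> V a)
      = (\<Oplus>\<^bsub>B\<^esub>a\<in>c ` ?S. if c w = a then (f w \<otimes> q [^] \<nu> w) \<odot>\<^bsub>B\<^esub> V a else \<zero>\<^bsub>B\<^esub>)"
      using w S fF Vc by (intro h.B.finsum_cong') (auto simp: F_sel weight_def)
    also have "\<dots> = (f w \<otimes> q [^] \<nu> w) \<odot>\<^bsub>B\<^esub> V (c w)"
      using w S fF Vc by (intro h.B.finsum_singleton) (auto simp: F_sel)
    also have "\<dots> = f w \<odot>\<^bsub>B\<^esub> h (basis_elt K w)"
      using w S fF Vc V(2)[of w] by (subst h.B.smult_assoc1) (auto simp: F_sel subset_eq)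
    finally show "f w \<odot>\<^bsub>B\<^esub> h (basis_elt K w) = (\<Oplus>\<^bsub>B\<^esub>a\<in>c ` ?S. (f w \<otimes> weight a w) \<odot>\<^bsub>B\<^esub> V a)" by simp
  qed (use fF Vc in \<open>auto intro!: h.B.finsum_closed simp: F_sel\<close>)
  also have "\<dots> = (\<Oplus>\<^bsub>B\<^esub>a\<in>c ` ?S. \<Oplus>\<^bsub>B\<^esub>w\<in>?S. (f w \<otimes> weight a w) \<odot>\<^bsub>B\<^esub> V a)"
    using S fF Vc by (intro h.B.finsum_swap) (auto simp: F_sel)
  also have "\<dots> = (\<Oplus>\<^bsub>B\<^esub>a\<in>c ` ?S. \<zero>\<^bsub>B\<^esub>)"
  proof (intro h.B.finsum_cong' refl)
    fix a assume a: "a \<in> c ` ?S"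
    have "(\<Oplus>\<^bsub>B\<^esub>w\<in>?S. (f w \<otimes> weight a w) \<odot>\<^bsub>B\<^esub> V a) = coef a f \<odot>\<^bsub>B\<^esub> V a"
      unfolding coef_def pair_def using S fF Vc[OF a]
      by (intro h.B.finsum_smult_rdistr[symmetric]) (auto simp: F_sel)
    then show "(\<Oplus>\<^bsub>B\<^esub>w\<in>?S. (f w \<otimes> weight a w) \<odot>\<^bsub>B\<^esub> V a) = \<zero>\<^bsub>B\<^esub>" using f0 Vc[OF a] by simp
  qed auto
  finally show ?thesis by simp
qed

text \<open>The regrouping of \<open>hom_null\<close> for scalars: the pairing is the sum of
  \<open>coef a f\<close> times \<open>G a\<close>, and only the content \<open>d\<close> survives.
  This isolates leading terms.\<close>

lemma pair_eq_single_coef: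
  assumes f: "f \<in> carrier F" and G: "\<And>a. G a \<in> carrier K"
    and zero: "\<And>a. a \<noteq> d \<Longrightarrow> coef a f = \<zero> \<or> G a = \<zero>"
  shows "pair f (\<lambda>w. q [^] \<nu> w \<otimes> G (c w)) = coef d f \<otimes> G d"
proof -
  \<comment> \<open>\<open>d\<close> is inserted so that the sum runs over it even when no word of
    \<open>f\<close> has this content.\<close>
  let ?S = "supp K f" and ?A = "insert d (c ` supp K f)"
  have S: "finite ?S" using f F_sel by auto
  have "pair f (\<lambda>w. q [^] \<nu> w \<otimes> G (c w)) = (\<Oplus>w\<in>?S. \<Oplus>a\<in>?A. (f w \<otimes> weight a w) \<otimes> G a)"
    unfolding pair_def
  proof (intro finsum_cong' refl)
    fix w assume w: "w \<in> ?S"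
    have "(\<Oplus>a\<in>?A. (f w \<otimes> weight a w) \<otimes> G a)
      = (\<Oplus>a\<in>?A. if c w = a then f w \<otimes> (q [^] \<nu> w \<otimes> G a) else \<zero>)"
      using f G by (intro finsum_cong') (auto simp: F_sel weight_def m_assoc)
    also have "\<dots> = f w \<otimes> (q [^] \<nu> w \<otimes> G (c w))"
      using w S f G by (intro finsum_singleton) (auto simp: F_sel)
    finally show "f w \<otimes> (q [^] \<nu> w \<otimes> G (c w)) = (\<Oplus>a\<in>?A. (f w \<otimes> weight a w) \<otimes> G a)" by simp
  qed (use f G in \<open>auto intro!: finsum_closed simp: F_sel\<close>)
  also have "\<dots> = (\<Oplus>a\<in>?A. \<Oplus>w\<in>?S. (f w \<otimes> weight a w) \<otimes> G a)"
    using S f G by (intro finsum_swap) (auto simp: F_sel)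
  also have "\<dots> = (\<Oplus>a\<in>?A. if d = a then coef a f \<otimes> G a else \<zero>)"
  proof (intro finsum_cong' refl)
    fix a assume a: "a \<in> ?A"
    have "(\<Oplus>w\<in>?S. (f w \<otimes> weight a w) \<otimes> G a) = coef a f \<otimes> G a"
      unfolding coef_def pair_def using S f G
      by (intro finsum_ldistr[symmetric]) (auto simp: F_sel)
    then show "(\<Oplus>w\<in>?S. (f w \<otimes> weight a w) \<otimes> G a) = (if d = a then coef a f \<otimes> G a else \<zero>)"
      using zero[of a] f G coef_closed[OF f] by auto
  qed (use f G in auto)
  also have "\<dots> = coef d f \<otimes> G d"
    using S f G by (intro finsum_singleton) auto
  finally show ?thesis .
qed

lemma coef_support_finite: "f \<in> carrier F \<Longrightarrow> finite {e. coef e f \<noteq> \<zero>}"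
proof (rule finite_subset)
  assume f: "f \<in> carrier F"
  show "finite (c ` supp K f)" using f F_sel by auto
  show "{e. coef e f \<noteq> \<zero>} \<subseteq> c ` supp K f"
  proof (rule ccontr)
    assume "\<not> ?thesis"
    then obtain e where e: "coef e f \<noteq> \<zero>" "e \<notin> c ` supp K f" by auto
    have "coef e f = (\<Oplus>w\<in>supp K f. \<zero>)" unfolding coef_def pair_def
      by (intro finsum_cong') (use e f in \<open>auto simp: weight_def F_sel\<close>)
    with e show False by simp
  qed
qed

text \<open>Leading terms: the product of the two top coefficients is, up to a power of \<open>q\<close>, the top
  coefficient of the product.\<close>

lemma null_ideal_prime:
  assumes f: "f \<in> carrier F" "f \<notin> null_ideal" and g: "g \<in> carrier F" "g \<notin> null_ideal"
  shows "f \<otimes>\<^bsub>F\<^esub> g \<notin> null_ideal"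
proof -
  define d where "d = Max {e. coef e f \<noteq> \<zero>}"
  define e where "e = Max {e. coef e g \<noteq> \<zero>}"
  have ne: "{e. coef e f \<noteq> \<zero>} \<noteq> {}" "{e. coef e g \<noteq> \<zero>} \<noteq> {}"
    using f g by (auto simp: null_ideal_def)
  have d: "coef d f \<noteq> \<zero>" "\<And>a. d < a \<Longrightarrow> coef a f = \<zero>"
    using Max_in[OF coef_support_finite[OF f(1)] ne(1)] Max_ge[OF coef_support_finite[OF f(1)]]
    unfolding d_def by (auto simp: not_le[symmetric])
  have e: "coef e g \<noteq> \<zero>" "\<And>a. e < a \<Longrightarrow> coef a g = \<zero>"
    using Max_in[OF coef_support_finite[OF g(1)] ne(2)] Max_ge[OF coef_support_finite[OF g(1)]]
    unfolding e_def by (auto simp: not_le[symmetric])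
  \<comment> \<open>What remains of the coefficient at \<open>d + e\<close>, apart from
    \<open>q [^] \<nu> u\<close>, after summing over the words of \<open>g\<close>; it depends on
    \<open>u\<close> only through \<open>a = c u\<close>.\<close>
  define G where "G a = (if d + e = a + (d + e - a)
    then q [^] b a (d + e - a) \<otimes> coef (d + e - a) g else \<zero>)" for a
  have Gc: "G a \<in> carrier K" for a using g by (simp add: G_def)
  have "pair g (\<lambda>v. weight (d + e) (u @ v)) = q [^] \<nu> u \<otimes> G (c u)" if "u \<in> lists X" for u
    using g by (simp add: weight_append_left pair_smult2 G_def m_assoc flip: coef_def nat_pow_mult)
  then have "coef (d + e) (f \<otimes>\<^bsub>F\<^esub> g) = pair f (\<lambda>u. q [^] \<nu> u \<otimes> G (c u))"
    unfolding coef_mult[OF f(1) g(1)] by (intro pair_cong) (use f g Gc in auto)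
  also have "\<dots> = coef d f \<otimes> G d"
  proof (rule pair_eq_single_coef[OF f(1) Gc])
    fix a assume "a \<noteq> d"
    then consider "d < a" | "a < d" by (meson linorder_neqE)
    then show "coef a f = \<zero> \<or> G a = \<zero>"
    proof cases
      case 2
      \<comment> \<open>If \<open>a\<close> and its complement add up to \<open>d + e\<close>, then
        \<open>a\<close> below \<open>d\<close> forces the complement above the top content
        \<open>e\<close> of \<open>g\<close>, by strict monotonicity of addition.\<close>
      have "e < d + e - a" if *: "d + e = a + (d + e - a)"
      proof (rule ccontr)
        assume "\<not> e < d + e - a"
        then have "a + (d + e - a) \<le> a + e"
          using add_less[of "d + e - a" e a] by (auto simp: add.commute not_less order.order_iff_strict)
        also have "a + e < d + e" using 2 by (rule add_less)
        finally show False using * by simp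
      qed
      then have "G a = \<zero>" using e(2) by (auto simp: G_def)
      then show ?thesis ..
    qed (use d in auto)
  qed
  \<comment> \<open>At \<open>a = d\<close> the complement is \<open>e\<close>, so
    \<open>G d\<close> is a power of \<open>q\<close> times the top coefficient of
    \<open>g\<close>.\<close>
  also have "\<dots> \<noteq> \<zero>"
    using d e f g by (simp add: G_def integral_iff)
  finally show ?thesis by (auto simp: null_ideal_def)
qed

lemma one_notin_null_ideal: "\<one>\<^bsub>F\<^esub> \<notin> null_ideal"
proof -
  have "coef (c []) \<one>\<^bsub>F\<^esub> = q [^] \<nu> []" by (simp add: F_ops coef_basis weight_def)
  then show ?thesis unfolding null_ideal_def using q_pow_nonzero by fastforce
qed

end

subsection \<open>Sorting words by adjacent exchanges\<close>

text \<open>Adjacent transpositions generate all rearrangements: the head of \<open>xs\<close> is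
  found in \<open>ys\<close>, the remaining entries are matched, and the head is then carried into
  place.\<close>

lemma adjacent_swap_induct [consumes 1, case_names refl trans swap]:
  assumes "mset xs = mset ys"
    and refl: "\<And>xs. P xs xs"
    and trans: "\<And>xs ys zs. P xs ys \<Longrightarrow> P ys zs \<Longrightarrow> P xs zs"
    and swap: "\<And>u x y v. P (u @ x # y # v) (u @ y # x # v)"
  shows "P xs ys"
proof -
  have move: "P (u @ x # w @ v) (u @ w @ x # v)" for u x w v
  proof (induction w arbitrary: u)
    case Nil
    show ?case using refl by simp
  next
    case (Cons y w)
    show ?case using trans[OF swap[of u x y "w @ v"]] Cons[of "u @ [y]"] by simp
  qed
  \<comment> \<open>The prefix \<open>u\<close> is arbitrary so that the common head can be absorbed
    into it.\<close>
  have "P (u @ xs) (u @ ys)" for u using assms(1)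
  proof (induction xs arbitrary: u ys)
    case Nil
    then show ?case using refl by simp
  next
    case (Cons x xs)
    then have "x \<in> set ys" by (metis list.set_intros(1) mset_eq_setD)
    then obtain w v where ys: "ys = w @ x # v" by (auto simp: in_set_conv_decomp)
    have "P ((u @ [x]) @ xs) ((u @ [x]) @ w @ v)"
      using Cons.prems by (intro Cons.IH) (simp add: ys)
    then show ?case using trans move[of u x w v] by (simp add: ys)
  qed
  from this[of "[]"] show ?thesis by simp
qed

text \<open>Counts all pairs of positions with strictly increasing entries, not only neighbouring
  ones.\<close>

primrec ascents :: "nat list \<Rightarrow> nat" where
  "ascents [] = 0"
| "ascents (x # xs) = length (filter ((<) x) xs) + ascents xs"

definition cross_ascents :: "nat multiset \<Rightarrow> nat multiset \<Rightarrow> nat"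
  where "cross_ascents A B = (\<Sum>a\<in>#A. size (filter_mset ((<) a) B))"

lemma ascents_append: "ascents (u @ v) = ascents u + ascents v + cross_ascents (mset u) (mset v)"
  by (induction u) (simp_all add: cross_ascents_def flip: mset_filter)

text \<open>The cross terms see only multisets, which the swap preserves; the pair itself is the one
  contribution that changes.\<close>

lemma ascents_adjacent_swap:
  "x < y \<Longrightarrow> ascents (u @ x # y # v) = Suc (ascents (u @ y # x # v))"
  by (simp add: ascents_append add_mset_commute)

definition matrix_content :: "(nat \<times> nat) list \<Rightarrow> nat multiset \<times> nat multiset"
  where "matrix_content w = (mset (map fst w), mset (map snd w))"

definition matrix_ascents :: "(nat \<times> nat) list \<Rightarrow> nat"
  where "matrix_ascents w = ascents (map fst w) + ascents (map snd w)"

lemma affine_weighted_words: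
  assumes "field K" "q \<in> carrier K" "q \<noteq> \<zero>\<^bsub>K\<^esub>"
  shows "weighted_words K mset ascents cross_ascents q"
  by (intro weighted_words.intro weighted_words_axioms.intro assms) (simp_all add: ascents_append)

text \<open>Contents are ordered lexicographically, each component by the multiset order, and
  addition is strictly monotone for both.\<close>

lemma matrix_weighted_words:
  assumes "field K" "q \<in> carrier K" "q \<noteq> \<zero>\<^bsub>K\<^esub>"
  shows "weighted_words K matrix_content matrix_ascents
    (\<lambda>(r, s) (r', s'). cross_ascents r r' + cross_ascents s s') q"
  by (intro weighted_words.intro weighted_words_axioms.intro assms)
    (auto simp: matrix_content_def matrix_ascents_def ascents_append less_prod_def')

text \<open>Given the four commutation relations of quantum matrices, the vanishing of the \<open>2 \<times> 2\<close> minors is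
  equivalent to the following two exchange rules; they sort the row indices and the
  column indices of a word independently.\<close>

locale exchange_family = assoc_algebra K B + K: field K
  for K (structure) and B (structure) +
  fixes q and m n :: nat and x :: "nat \<Rightarrow> nat \<Rightarrow> 'c"
  assumes q [simp]: "q \<in> carrier K" "q \<noteq> \<zero>\<^bsub>K\<^esub>"
    and x_closed [simp]: "(i, j) \<in> qmat_index m n \<Longrightarrow> x i j \<in> carrier B"
    and row_exchange: "(i, j) \<in> qmat_index m n \<Longrightarrow> (l, s) \<in> qmat_index m n \<Longrightarrow> i < l \<Longrightarrow>
      x i j \<otimes>\<^bsub>B\<^esub> x l s = q \<odot>\<^bsub>B\<^esub> (x l j \<otimes>\<^bsub>B\<^esub> x i s)"
    and column_exchange: "(i, j) \<in> qmat_index m n \<Longrightarrow> (l, s) \<in> qmat_index m n \<Longrightarrow> j < s \<Longrightarrow>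
      x i j \<otimes>\<^bsub>B\<^esub> x l s = q \<odot>\<^bsub>B\<^esub> (x i s \<otimes>\<^bsub>B\<^esub> x l j)"
begin

section \<open>Products along words and their normal forms\<close>

definition word where "word w = foldr (\<lambda>(i, j) a. x i j \<otimes>\<^bsub>B\<^esub> a) w \<one>\<^bsub>B\<^esub>"

lemma word_simps [simp]: "word [] = \<one>\<^bsub>B\<^esub>" "word ((i, j) # w) = x i j \<otimes>\<^bsub>B\<^esub> word w"
  by (simp_all add: word_def)

lemma word_closed [simp]: "w \<in> lists (qmat_index m n) \<Longrightarrow> word w \<in> carrier B"
  by (induction w) auto

lemma word_append:
  "u \<in> lists (qmat_index m n) \<Longrightarrow> v \<in> lists (qmat_index m n) \<Longrightarrow> word (u @ v) = word u \<otimes>\<^bsub>B\<^esub> word v"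
proof (induction u)
  case (Cons a u)
  then show ?case by (cases a) (simp add: m_assoc)
qed simp

lemma word_exchange:
  assumes "u \<in> lists (qmat_index m n)" "v \<in> lists (qmat_index m n)"
    and "{(i, j), (l, s), (i', j'), (l', s')} \<subseteq> qmat_index m n"
    and "x i j \<otimes>\<^bsub>B\<^esub> x l s = q \<odot>\<^bsub>B\<^esub> (x i' j' \<otimes>\<^bsub>B\<^esub> x l' s')"
  shows "word (u @ (i, j) # (l, s) # v) = q \<odot>\<^bsub>B\<^esub> word (u @ (i', j') # (l', s') # v)"
proof -
  have "x i j \<otimes>\<^bsub>B\<^esub> (x l s \<otimes>\<^bsub>B\<^esub> word v) = (x i j \<otimes>\<^bsub>B\<^esub> x l s) \<otimes>\<^bsub>B\<^esub> word v"
    using assms(1-3) by (simp add: m_assoc)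
  also have "\<dots> = q \<odot>\<^bsub>B\<^esub> (x i' j' \<otimes>\<^bsub>B\<^esub> (x l' s' \<otimes>\<^bsub>B\<^esub> word v))"
    using assms by (simp add: m_assoc smult_mult_left)
  finally show ?thesis
    using assms(1-3) by (simp add: word_append smult_mult_right)
qed

text \<open>The product with its power of \<open>q\<close> divided out. Row and column indices are
  two lists so that they can be permuted independently.\<close>

definition normed where
  "normed r s = inv\<^bsub>K\<^esub> (q [^]\<^bsub>K\<^esub> (ascents r + ascents s)) \<odot>\<^bsub>B\<^esub> word (zip r s)"

lemma q_pow_Units: "q [^]\<^bsub>K\<^esub> (k::nat) \<in> Units K"
  using q by (induction k) (simp_all add: K.field_Units K.integral_iff)

lemma inv_q_pow [simp]: "inv\<^bsub>K\<^esub> (q [^]\<^bsub>K\<^esub> (k::nat)) \<in> carrier K"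
  using q_pow_Units by (rule R.Units_inv_closed)

lemma inv_q_pow_Suc:
  assumes "y \<in> carrier B"
  shows "inv\<^bsub>K\<^esub> (q [^]\<^bsub>K\<^esub> Suc k) \<odot>\<^bsub>B\<^esub> (q \<odot>\<^bsub>B\<^esub> y) = inv\<^bsub>K\<^esub> (q [^]\<^bsub>K\<^esub> k) \<odot>\<^bsub>B\<^esub> y"
proof -
  let ?a = "q [^]\<^bsub>K\<^esub> k" and ?i = "inv\<^bsub>K\<^esub> (q [^]\<^bsub>K\<^esub> Suc k)"
  have "?a \<otimes>\<^bsub>K\<^esub> (?i \<otimes>\<^bsub>K\<^esub> q) = ?i \<otimes>\<^bsub>K\<^esub> (q [^]\<^bsub>K\<^esub> Suc k)"
    by (simp add: R.m_comm R.m_lcomm del: inv_q_pow) (use inv_q_pow[of "Suc k"] in \<open>simp add: R.m_ac\<close>)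
  also have "\<dots> = \<one>\<^bsub>K\<^esub>" using q_pow_Units by (rule R.Units_l_inv)
  finally have "?i \<otimes>\<^bsub>K\<^esub> q = inv\<^bsub>K\<^esub> ?a"
    using inv_q_pow[of "Suc k"] by (intro R.comm_inv_char[symmetric]) auto
  then show ?thesis
    using assms smult_assoc1[OF inv_q_pow q(1), of y "Suc k"] by (simp del: R.nat_pow_Suc)
qed

text \<open>Exchanging neighbouring rows \<open>i < l\<close> costs a factor \<open>q\<close> and
  lowers the ascent number by one, so the normalisation absorbs it.\<close>

lemma normed_rows:
  assumes "mset r = mset r'" "length r = length s" "set r \<subseteq> {1..m}" "set s \<subseteq> {1..n}"
  shows "normed r s = normed r' s"
proof -
  have zl: "zip u t \<in> lists (qmat_index m n)" if "set u \<subseteq> {1..m}" "set t \<subseteq> {1..n}" for u t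
    using that by (auto simp: qmat_index_def subset_eq dest: set_zip_leftD set_zip_rightD)
  have less: "normed (u @ i # l # v) s = normed (u @ l # i # v) s"
    if il: "i < l" and len: "length (u @ i # l # v) = length s" and st: "set (u @ i # l # v) \<subseteq> {1..m}"
    for u i l v
  proof -
    have "length s > length u + 1" using len by simp
    \<comment> \<open>\<open>j\<close> and \<open>t\<close> are the columns at the two exchanged
      positions; they stay in place.\<close>
    then obtain s1 j t s2 where s: "s = s1 @ j # t # s2" "length s1 = length u"
      by (metis (no_types, lifting) id_take_nth_drop Suc_eq_plus1 Suc_lessD append.assoc
          Cons_nth_drop_Suc append_take_drop_id length_take min.absorb4)
    have "word (zip (u @ i # l # v) s) = q \<odot>\<^bsub>B\<^esub> word (zip (u @ l # i # v) s)"
    proof -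
      have "word (zip u s1 @ (i, j) # (l, t) # zip v s2) = q \<odot>\<^bsub>B\<^esub> word (zip u s1 @ (l, j) # (i, t) # zip v s2)"
        by (rule word_exchange[OF zl zl _ row_exchange]) (use s st assms(4) il in \<open>auto simp: qmat_index_def\<close>)
      then show ?thesis using s by simp
    qed
    moreover have "zip (u @ l # i # v) s \<in> lists (qmat_index m n)"
      using st assms(4) by (intro zl) auto
    ultimately show ?thesis
      using ascents_adjacent_swap[OF il, of u v] by (simp only: normed_def add_Suc inv_q_pow_Suc word_closed)
  qed
  \<comment> \<open>Length and range conditions are propagated as well, because transitivity needs
    them for the intermediate list.\<close>
  have "length r = length s \<and> set r \<subseteq> {1..m} \<longrightarrow> length r' = length s \<and> set r' \<subseteq> {1..m} \<and> normed r s = normed r' s"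
    using assms(1)
  proof (induction rule: adjacent_swap_induct)
    case (swap u i l v)
    show ?case using less[of i l u v] less[of l i u v] by (cases i l rule: linorder_cases) auto
  qed auto
  then show ?thesis using assms by simp
qed

lemma normed_columns:
  assumes "mset s = mset s'" "length r = length s" "set r \<subseteq> {1..m}" "set s \<subseteq> {1..n}"
  shows "normed r s = normed r s'"
proof -
  have zl: "zip u t \<in> lists (qmat_index m n)" if "set u \<subseteq> {1..m}" "set t \<subseteq> {1..n}" for u t
    using that by (auto simp: qmat_index_def subset_eq dest: set_zip_leftD set_zip_rightD)
  have less: "normed r (u @ j # t # v) = normed r (u @ t # j # v)"
    if jt: "j < t" and len: "length r = length (u @ j # t # v)" and st: "set (u @ j # t # v) \<subseteq> {1..n}"
    for u j t v
  proof -
    have "length r > length u + 1" using len by simp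
    then obtain r1 i l r2 where r: "r = r1 @ i # l # r2" "length r1 = length u"
      by (metis (no_types, lifting) id_take_nth_drop Suc_eq_plus1 Suc_lessD append.assoc
          Cons_nth_drop_Suc append_take_drop_id length_take min.absorb4)
    have "word (zip r (u @ j # t # v)) = q \<odot>\<^bsub>B\<^esub> word (zip r (u @ t # j # v))"
    proof -
      have "word (zip r1 u @ (i, j) # (l, t) # zip r2 v) = q \<odot>\<^bsub>B\<^esub> word (zip r1 u @ (i, t) # (l, j) # zip r2 v)"
        by (rule word_exchange[OF zl zl _ column_exchange]) (use r st assms(3) jt in \<open>auto simp: qmat_index_def\<close>)
      then show ?thesis using r by simp
    qed
    moreover have "zip r (u @ t # j # v) \<in> lists (qmat_index m n)"
      using st assms(3) by (intro zl) auto
    ultimately show ?thesis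
      using ascents_adjacent_swap[OF jt, of u v] by (simp only: normed_def add_Suc_right inv_q_pow_Suc word_closed)
  qed
  have "length r = length s \<and> set s \<subseteq> {1..n} \<longrightarrow> length r = length s' \<and> set s' \<subseteq> {1..n} \<and> normed r s = normed r s'"
    using assms(1)
  proof (induction rule: adjacent_swap_induct)
    case (swap u j t v)
    show ?case using less[of j t u v] less[of t j u v] by (cases j t rule: linorder_cases) auto
  qed auto
  then show ?thesis using assms by simp
qed

definition standard where
  "standard = (\<lambda>(r, s). normed (sorted_list_of_multiset r) (sorted_list_of_multiset s))"

text \<open>Rows are sorted with the columns held fixed, then columns with the rows fixed; the
  remaining power of \<open>q\<close> is a unit and moves to the other side.\<close>

lemma word_eq_standard:
  assumes w: "w \<in> lists (qmat_index m n)"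
  shows "standard (matrix_content w) \<in> carrier B"
    and "word w = q [^]\<^bsub>K\<^esub> matrix_ascents w \<odot>\<^bsub>B\<^esub> standard (matrix_content w)"
proof -
  let ?r = "map fst w" and ?s = "map snd w"
  let ?r' = "sorted_list_of_multiset (mset ?r)" and ?s' = "sorted_list_of_multiset (mset ?s)"
  have sub: "set ?r \<subseteq> {1..m}" "set ?s \<subseteq> {1..n}" using w by (auto simp: qmat_index_def subset_eq)
  have "normed ?r ?s = normed ?r' ?s" by (rule normed_rows) (use sub in auto)
  also have "\<dots> = normed ?r' ?s'"
    proof (rule normed_columns)
    show "length ?r' = length ?s" by (metis length_map mset_sorted_list_of_multiset size_mset)
  qed (use sub in auto)
  finally have st: "standard (matrix_content w) = inv\<^bsub>K\<^esub> (q [^]\<^bsub>K\<^esub> matrix_ascents w) \<odot>\<^bsub>B\<^esub> word w"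
    by (simp add: standard_def matrix_content_def normed_def matrix_ascents_def zip_map_fst_snd)
  show "standard (matrix_content w) \<in> carrier B" using w by (simp add: st)
  show "word w = q [^]\<^bsub>K\<^esub> matrix_ascents w \<odot>\<^bsub>B\<^esub> standard (matrix_content w)"
    unfolding st using w q_pow_Units[of "matrix_ascents w"]
    by (subst smult_assoc1[symmetric]) simp_all
qed

end

subsection \<open>The relations of quantum matrices as exchange rules\<close>

lemma qmat_index_iff: "(i, j) \<in> qmat_index m n \<longleftrightarrow> i \<in> {1..m} \<and> j \<in> {1..n}"
  by (simp add: qmat_index_def)

lemma free_alg_assoc_algebra: "cring K \<Longrightarrow> assoc_algebra K (free_alg K X)"
  unfolding free_alg_def by (intro mon_alg.F_algebra mon_alg.intro free_monoid_monoid)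

lemma free_gen_closed: "cring K \<Longrightarrow> x \<in> X \<Longrightarrow> free_gen K x \<in> carrier (free_alg K X)"
  unfolding free_alg_def free_gen_def
  by (intro mon_alg.basis_F mon_alg.intro free_monoid_monoid) (simp_all add: free_monoid_def)

text \<open>Lift of the minor in rows \<open>i\<close>, \<open>l\<close> and columns
  \<open>j\<close>, \<open>s\<close>, so that one homomorphism can be tested on minors and defining
  relations alike.\<close>

definition free_minor ::
  "('k, 'c) ring_scheme \<Rightarrow> 'k \<Rightarrow> nat \<Rightarrow> nat \<Rightarrow> nat \<Rightarrow> nat \<Rightarrow> nat \<Rightarrow> nat \<Rightarrow> (nat \<times> nat) list \<Rightarrow> 'k"
  where "free_minor K q m n i l j s = (let F = free_alg K (qmat_index m n); X = (\<lambda>i j. free_gen K (i, j)) in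
    X i j \<otimes>\<^bsub>F\<^esub> X l s \<ominus>\<^bsub>F\<^esub> q \<odot>\<^bsub>F\<^esub> (X i s \<otimes>\<^bsub>F\<^esub> X l j))"

text \<open>\<open>h\<close> is not yet subject to any relation. It will be the embedding, the
  projection modulo the minors, or the projection onto quantum matrices.\<close>

locale qmat_hom = algebra_hom K "free_alg K (qmat_index m n)" B h + K: field K
  for K (structure) and q and m n :: nat and B (structure) and h +
  assumes q [simp]: "q \<in> carrier K" "q \<noteq> \<zero>\<^bsub>K\<^esub>"
begin

definition x where "x i j = h (free_gen K (i, j))"

lemma gen_closed [simp]: "(i, j) \<in> qmat_index m n \<Longrightarrow> free_gen K (i, j) \<in> carrier (free_alg K (qmat_index m n))"
  by (rule free_gen_closed) (simp_all add: A.R.is_cring)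

lemma x_closed [simp]: "(i, j) \<in> qmat_index m n \<Longrightarrow> x i j \<in> carrier B"
  by (simp add: x_def)

lemma q_inv [simp]: "inv\<^bsub>K\<^esub> q \<in> carrier K" "q \<ominus>\<^bsub>K\<^esub> inv\<^bsub>K\<^esub> q \<in> carrier K"
  using q by (simp_all add: K.field_Units)

lemma h_minor:
  assumes "{(i, j), (l, s)} \<subseteq> qmat_index m n"
  shows "h (free_minor K q m n i l j s) = x i j \<otimes>\<^bsub>B\<^esub> x l s \<ominus>\<^bsub>B\<^esub> q \<odot>\<^bsub>B\<^esub> (x i s \<otimes>\<^bsub>B\<^esub> x l j)"
proof -
  have "(i, s) \<in> qmat_index m n" "(l, j) \<in> qmat_index m n" using assms by (auto simp: qmat_index_iff)
  with assms show ?thesis by (simp add: free_minor_def Let_def minus x_def)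
qed

text \<open>The minors give \<open>diag\<close>; inserted into the fourth relation they give
  \<open>anti_diag\<close>. With the first three relations this covers every relative position of
  two index pairs.\<close>

lemma exchange_familyI:
  assumes rels: "\<And>r. r \<in> qmat_rels K q m n \<Longrightarrow> h r = \<zero>\<^bsub>B\<^esub>"
    and minors: "\<And>i l j s. \<lbrakk>1 \<le> i; i < l; l \<le> m; 1 \<le> j; j < s; s \<le> n\<rbrakk> \<Longrightarrow>
      h (free_minor K q m n i l j s) = \<zero>\<^bsub>B\<^esub>"
  shows "exchange_family K B q m n x"
proof -
  have col: "x i j \<otimes>\<^bsub>B\<^esub> x l j = q \<odot>\<^bsub>B\<^esub> (x l j \<otimes>\<^bsub>B\<^esub> x i j)"
    if "i \<in> {1..m}" "l \<in> {1..m}" "j \<in> {1..n}" "i < l" for i l j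
  proof -
    have "free_gen K (i,j) \<otimes>\<^bsub>free_alg K (qmat_index m n)\<^esub> free_gen K (l,j)
      \<ominus>\<^bsub>free_alg K (qmat_index m n)\<^esub> q \<odot>\<^bsub>free_alg K (qmat_index m n)\<^esub>
        (free_gen K (l,j) \<otimes>\<^bsub>free_alg K (qmat_index m n)\<^esub> free_gen K (i,j)) \<in> qmat_rels K q m n"
      unfolding qmat_rels_def Let_def using that by blast
    from rels[OF this] show ?thesis using that
      by (simp add: minus B.minus_eq_zero_iff qmat_index_iff flip: x_def)
  qed
  have row: "x i j \<otimes>\<^bsub>B\<^esub> x i s = q \<odot>\<^bsub>B\<^esub> (x i s \<otimes>\<^bsub>B\<^esub> x i j)"
    if "i \<in> {1..m}" "j \<in> {1..n}" "s \<in> {1..n}" "j < s" for i j s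
  proof -
    have "free_gen K (i,j) \<otimes>\<^bsub>free_alg K (qmat_index m n)\<^esub> free_gen K (i,s)
      \<ominus>\<^bsub>free_alg K (qmat_index m n)\<^esub> q \<odot>\<^bsub>free_alg K (qmat_index m n)\<^esub>
        (free_gen K (i,s) \<otimes>\<^bsub>free_alg K (qmat_index m n)\<^esub> free_gen K (i,j)) \<in> qmat_rels K q m n"
      unfolding qmat_rels_def Let_def using that by blast
    from rels[OF this] show ?thesis using that
      by (simp add: minus B.minus_eq_zero_iff qmat_index_iff flip: x_def)
  qed
  have anti: "x i s \<otimes>\<^bsub>B\<^esub> x l j = x l j \<otimes>\<^bsub>B\<^esub> x i s"
    if "i \<in> {1..m}" "l \<in> {1..m}" "j \<in> {1..n}" "s \<in> {1..n}" "i < l" "j < s" for i l j s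
  proof -
    have "free_gen K (i,s) \<otimes>\<^bsub>free_alg K (qmat_index m n)\<^esub> free_gen K (l,j)
      \<ominus>\<^bsub>free_alg K (qmat_index m n)\<^esub>
        free_gen K (l,j) \<otimes>\<^bsub>free_alg K (qmat_index m n)\<^esub> free_gen K (i,s) \<in> qmat_rels K q m n"
      unfolding qmat_rels_def Let_def using that by blast
    from rels[OF this] show ?thesis using that
      by (simp add: minus B.minus_eq_zero_iff qmat_index_iff flip: x_def)
  qed
  have comm: "x i j \<otimes>\<^bsub>B\<^esub> x l s \<ominus>\<^bsub>B\<^esub> x l s \<otimes>\<^bsub>B\<^esub> x i j = (q \<ominus>\<^bsub>K\<^esub> inv\<^bsub>K\<^esub> q) \<odot>\<^bsub>B\<^esub> (x i s \<otimes>\<^bsub>B\<^esub> x l j)"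
    if "i \<in> {1..m}" "l \<in> {1..m}" "j \<in> {1..n}" "s \<in> {1..n}" "i < l" "j < s" for i l j s
  proof -
    have "(free_gen K (i,j) \<otimes>\<^bsub>free_alg K (qmat_index m n)\<^esub> free_gen K (l,s)
      \<ominus>\<^bsub>free_alg K (qmat_index m n)\<^esub>
        free_gen K (l,s) \<otimes>\<^bsub>free_alg K (qmat_index m n)\<^esub> free_gen K (i,j))
      \<ominus>\<^bsub>free_alg K (qmat_index m n)\<^esub> (q \<ominus>\<^bsub>K\<^esub> inv\<^bsub>K\<^esub> q) \<odot>\<^bsub>free_alg K (qmat_index m n)\<^esub>
        (free_gen K (i,s) \<otimes>\<^bsub>free_alg K (qmat_index m n)\<^esub> free_gen K (l,j)) \<in> qmat_rels K q m n"
      unfolding qmat_rels_def Let_def using that by blast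
    from rels[OF this] show ?thesis using that
      by (simp add: minus B.minus_eq_zero_iff qmat_index_iff flip: x_def)
  qed
  have diag: "x i j \<otimes>\<^bsub>B\<^esub> x l s = q \<odot>\<^bsub>B\<^esub> (x i s \<otimes>\<^bsub>B\<^esub> x l j)"
    if "i \<in> {1..m}" "l \<in> {1..m}" "j \<in> {1..n}" "s \<in> {1..n}" "i < l" "j < s" for i l j s
    using minors[of i l j s] h_minor[of i j l s] that by (simp add: B.minus_eq_zero_iff qmat_index_iff)
  \<comment> \<open>Substituting \<open>diag\<close> brings the commutator relation into the shape
    of \<open>q_commutator_iff\<close>.\<close>
  have anti_diag: "x i s \<otimes>\<^bsub>B\<^esub> x l j = q \<odot>\<^bsub>B\<^esub> (x l s \<otimes>\<^bsub>B\<^esub> x i j)"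
    if "i \<in> {1..m}" "l \<in> {1..m}" "j \<in> {1..n}" "s \<in> {1..n}" "i < l" "j < s" for i l j s
    using comm[OF that] that B.q_commutator_iff[OF K.field_axioms q, of "x i s \<otimes>\<^bsub>B\<^esub> x l j" "x l s \<otimes>\<^bsub>B\<^esub> x i j"]
    by (simp add: diag[OF that] qmat_index_iff)
  show ?thesis
  proof (intro exchange_family.intro exchange_family_axioms.intro B.assoc_algebra_axioms K.field_axioms)
    fix i j l s assume "(i, j) \<in> qmat_index m n" "(l, s) \<in> qmat_index m n"
    then have I: "i \<in> {1..m}" "l \<in> {1..m}" "j \<in> {1..n}" "s \<in> {1..n}" by (auto simp: qmat_index_iff)
    show "x i j \<otimes>\<^bsub>B\<^esub> x l s = q \<odot>\<^bsub>B\<^esub> (x l j \<otimes>\<^bsub>B\<^esub> x i s)" if "i < l"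
    proof (cases j s rule: linorder_cases)
      case less
      then show ?thesis by (subst anti[OF I that less, symmetric]) (rule diag[OF I that less])
    next
      case equal
      then show ?thesis using col[OF I(1-3) that] by simp
    next
      case greater
      show ?thesis by (rule anti_diag[OF I(1,2,4,3) that greater])
    qed
    show "x i j \<otimes>\<^bsub>B\<^esub> x l s = q \<odot>\<^bsub>B\<^esub> (x i s \<otimes>\<^bsub>B\<^esub> x l j)" if "j < s"
    proof (cases i l rule: linorder_cases)
      case less
      show ?thesis by (rule diag[OF I less that])
    next
      case equal
      then show ?thesis using row[OF I(1,3,4) that] by simp
    next
      case greater
      \<comment> \<open>Commuting the two factors puts the smaller row \<open>l\<close> first, where
        \<open>anti_diag\<close> applies.\<close>
      show ?thesis
        using anti[OF I(2,1,3,4) greater that, symmetric] anti_diag[OF I(2,1,3,4) greater that] by (rule trans)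
    qed
  qed simp_all
qed

text \<open>Converse to \<open>exchange_familyI\<close>: for the embedding it is the exchange rules
  that can be read off directly, and the relations follow from them.\<close>

lemma
  assumes "exchange_family K B q m n x"
  shows exchange_rels: "r \<in> qmat_rels K q m n \<Longrightarrow> h r = \<zero>\<^bsub>B\<^esub>"
    and exchange_minors: "\<lbrakk>1 \<le> i; i < l; l \<le> m; 1 \<le> j; j < s; s \<le> n\<rbrakk> \<Longrightarrow>
      h (free_minor K q m n i l j s) = \<zero>\<^bsub>B\<^esub>"
proof -
  interpret exchange_family K B q m n x by fact
  have diag: "x i j \<otimes>\<^bsub>B\<^esub> x l s = q \<odot>\<^bsub>B\<^esub> (x i s \<otimes>\<^bsub>B\<^esub> x l j)"
    if "i \<in> {1..m}" "l \<in> {1..m}" "j \<in> {1..n}" "s \<in> {1..n}" "j < s" for i l j s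
    using that by (intro column_exchange) (auto simp: qmat_index_iff)
  have anti: "x i s \<otimes>\<^bsub>B\<^esub> x l j = q \<odot>\<^bsub>B\<^esub> (x l s \<otimes>\<^bsub>B\<^esub> x i j)"
    if "i \<in> {1..m}" "l \<in> {1..m}" "j \<in> {1..n}" "s \<in> {1..n}" "i < l" for i l j s
    using that by (intro row_exchange) (auto simp: qmat_index_iff)
  show "h r = \<zero>\<^bsub>B\<^esub>" if "r \<in> qmat_rels K q m n"
    using that unfolding qmat_rels_def Let_def
  proof (elim UnE CollectE exE conjE)
    fix i l j
    assume "r = free_gen K (i,j) \<otimes>\<^bsub>free_alg K (qmat_index m n)\<^esub> free_gen K (l,j)
      \<ominus>\<^bsub>free_alg K (qmat_index m n)\<^esub> q \<odot>\<^bsub>free_alg K (qmat_index m n)\<^esub>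
        (free_gen K (l,j) \<otimes>\<^bsub>free_alg K (qmat_index m n)\<^esub> free_gen K (i,j))"
      "i \<in> {1..m}" "l \<in> {1..m}" "j \<in> {1..n}" "i < l"
    then show ?thesis using anti[of i l j j]
      by (simp add: minus B.minus_eq_zero_iff qmat_index_iff flip: x_def)
  next
    fix i j s
    assume "r = free_gen K (i,j) \<otimes>\<^bsub>free_alg K (qmat_index m n)\<^esub> free_gen K (i,s)
      \<ominus>\<^bsub>free_alg K (qmat_index m n)\<^esub> q \<odot>\<^bsub>free_alg K (qmat_index m n)\<^esub>
        (free_gen K (i,s) \<otimes>\<^bsub>free_alg K (qmat_index m n)\<^esub> free_gen K (i,j))"
      "i \<in> {1..m}" "j \<in> {1..n}" "s \<in> {1..n}" "j < s"
    then show ?thesis using diag[of i i j s]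
      by (simp add: minus B.minus_eq_zero_iff qmat_index_iff flip: x_def)
  next
    fix i l j s
    assume "r = free_gen K (i,s) \<otimes>\<^bsub>free_alg K (qmat_index m n)\<^esub> free_gen K (l,j)
      \<ominus>\<^bsub>free_alg K (qmat_index m n)\<^esub>
        free_gen K (l,j) \<otimes>\<^bsub>free_alg K (qmat_index m n)\<^esub> free_gen K (i,s)"
      "i \<in> {1..m}" "l \<in> {1..m}" "j \<in> {1..n}" "s \<in> {1..n}" "i < l" "j < s"
    \<comment> \<open>Both sides equal \<open>q\<close> times the product of \<open>x l s\<close>
      and \<open>x i j\<close>, one by a row exchange and the other by a column exchange.\<close>
    moreover from this have "x i s \<otimes>\<^bsub>B\<^esub> x l j = x l j \<otimes>\<^bsub>B\<^esub> x i s"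
      using trans[OF anti[of i l j s] diag[of l i j s, symmetric]] by blast
    ultimately show ?thesis
      by (simp add: minus B.minus_eq_zero_iff qmat_index_iff flip: x_def)
  next
    fix i l j s
    assume "r = (free_gen K (i,j) \<otimes>\<^bsub>free_alg K (qmat_index m n)\<^esub> free_gen K (l,s)
      \<ominus>\<^bsub>free_alg K (qmat_index m n)\<^esub>
        free_gen K (l,s) \<otimes>\<^bsub>free_alg K (qmat_index m n)\<^esub> free_gen K (i,j))
      \<ominus>\<^bsub>free_alg K (qmat_index m n)\<^esub> (q \<ominus>\<^bsub>K\<^esub> inv\<^bsub>K\<^esub> q) \<odot>\<^bsub>free_alg K (qmat_index m n)\<^esub>
        (free_gen K (i,s) \<otimes>\<^bsub>free_alg K (qmat_index m n)\<^esub> free_gen K (l,j))"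
      and I: "i \<in> {1..m}" "l \<in> {1..m}" "j \<in> {1..n}" "s \<in> {1..n}" "i < l" "j < s"
    then have "h r = (x i j \<otimes>\<^bsub>B\<^esub> x l s \<ominus>\<^bsub>B\<^esub> x l s \<otimes>\<^bsub>B\<^esub> x i j)
        \<ominus>\<^bsub>B\<^esub> (q \<ominus>\<^bsub>K\<^esub> inv\<^bsub>K\<^esub> q) \<odot>\<^bsub>B\<^esub> (x i s \<otimes>\<^bsub>B\<^esub> x l j)"
      by (simp add: minus qmat_index_iff flip: x_def)
    \<comment> \<open>\<open>diag\<close> rewrites the first product as \<open>q\<close> times the
      antidiagonal one, and \<open>q_commutator_iff\<close> reduces the rest to a row
      exchange.\<close>
    then show ?thesis
      using I anti[of i l j s] B.q_commutator_iff[OF K.field_axioms q, of "x i s \<otimes>\<^bsub>B\<^esub> x l j" "x l s \<otimes>\<^bsub>B\<^esub> x i j"]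
      by (simp add: diag[OF I(1-4) I(6)] B.minus_eq_zero_iff qmat_index_iff)
  qed
  show "h (free_minor K q m n i l j s) = \<zero>\<^bsub>B\<^esub>" if "1 \<le> i" "i < l" "l \<le> m" "1 \<le> j" "j < s" "s \<le> n"
    using that h_minor[of i j l s] diag[of i l j s] by (simp add: B.minus_eq_zero_iff qmat_index_iff)
qed

lemma h_basis_word:
  assumes "exchange_family K B q m n x" "w \<in> lists (qmat_index m n)"
  shows "h (basis_elt K w) = exchange_family.word B x w"
proof -
  interpret exchange_family K B q m n x by fact
  interpret M: mon_alg K "free_monoid (qmat_index m n)"
    by (intro mon_alg.intro A.R.is_cring free_monoid_monoid)
  show ?thesis using assms(2)
  proof (induction w)
    case Nil
    have "\<one>\<^bsub>free_alg K (qmat_index m n)\<^esub> = basis_elt K []"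
      unfolding free_alg_def M.F_ops(4) by (simp add: free_monoid_def)
    then show ?case using one by simp
  next
    case (Cons a w)
    obtain i j where a: "a = (i, j)" by (cases a)
    have "basis_elt K (a # w) = free_gen K (i, j) \<otimes>\<^bsub>free_alg K (qmat_index m n)\<^esub> basis_elt K w"
      unfolding free_gen_def free_alg_def using Cons.hyps
      by (subst M.basis_mult) (auto simp: free_monoid_def a)
    moreover have "basis_elt K w \<in> carrier (free_alg K (qmat_index m n))"
      unfolding free_alg_def using Cons.hyps by (intro M.basis_F) (simp add: free_monoid_def)
    ultimately show ?case using Cons a by (simp flip: x_def)
  qed
qed

text \<open>The normal forms \<open>standard\<close> play the part of \<open>V\<close> in
  \<open>hom_null\<close>.\<close>

lemma exchange_null:
  assumes e: "exchange_family K B q m n x"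
    and f: "f \<in> weighted_words.null_ideal K (qmat_index m n) matrix_content matrix_ascents q"
  shows "h f = \<zero>\<^bsub>B\<^esub>"
proof -
  interpret e: exchange_family K B q m n x by fact
  interpret W: weighted_words K "qmat_index m n" matrix_content matrix_ascents
      "\<lambda>(r, s) (r', s'). cross_ascents r r' + cross_ascents s s'" q
    by (intro matrix_weighted_words K.field_axioms q)
  show ?thesis
  proof (rule W.hom_null[OF _ f])
    show "algebra_hom K (monoid_algebra K (free_monoid (qmat_index m n))) B h"
      using algebra_hom_axioms by (simp add: free_alg_def)
  qed (use e.word_eq_standard h_basis_word[OF e] in auto)
qed

end

subsection \<open>Quantum affine space and tensor products\<close>

lemma qmat_rels_closed:
  assumes "field K" "q \<in> carrier K" "q \<noteq> \<zero>\<^bsub>K\<^esub>"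
  shows "qmat_rels K q m n \<subseteq> carrier (free_alg K (qmat_index m n))"
proof -
  interpret K: field K by fact
  interpret F: assoc_algebra K "free_alg K (qmat_index m n)"
    by (rule free_alg_assoc_algebra[OF K.is_cring])
  have "inv\<^bsub>K\<^esub> q \<in> carrier K" using assms by (simp add: K.field_Units)
  then show ?thesis
    unfolding qmat_rels_def Let_def using assms
    by (auto intro!: F.minus_closed F.smult_closed F.m_closed free_gen_closed K.minus_closed
        simp: qmat_index_iff K.is_cring)
qed

lemma qaff_rels_closed:
  assumes "field K" "q \<in> carrier K"
  shows "qaff_rels K q n \<subseteq> carrier (free_alg K {1..n})"
proof -
  interpret K: field K by fact
  interpret F: assoc_algebra K "free_alg K {1..n}"
    by (rule free_alg_assoc_algebra[OF K.is_cring])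
  show ?thesis
    unfolding qaff_rels_def Let_def using assms
    by (auto simp del: One_nat_def simp: K.is_cring
        intro!: F.minus_closed F.smult_closed F.m_closed free_gen_closed)
qed

locale quantum_affine = weighted_words K "{1..n}" mset ascents cross_ascents q
  for K (structure) and q and n :: nat
begin

declare One_nat_def [simp del]

abbreviation "J \<equiv> Idl\<^bsub>F\<^esub> (qaff_rels K q n)"

lemma rels_closed: "qaff_rels K q n \<subseteq> carrier F"
  using qaff_rels_closed[OF field_axioms q(1)] by (simp add: free_alg_def)

lemma J_ideal: "ideal J F"
  by (intro F.genideal_ideal rels_closed)

lemma qaff_eq: "qaff K q n = quot_alg F J"
  by (simp add: qaff_def presented_alg_def free_alg_def)

sublocale p: algebra_hom K F "qaff K q n" "\<lambda>x. J +>\<^bsub>F\<^esub> x"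
  unfolding qaff_eq by (rule F.coset_algebra_hom[OF J_ideal])

definition mono :: "nat list \<Rightarrow> _" where "mono w = J +>\<^bsub>F\<^esub> basis_elt K w"

lemma mono_closed [simp]: "w \<in> lists {1..n} \<Longrightarrow> mono w \<in> carrier (qaff K q n)"
  by (simp add: mono_def basis_F)

lemma mono_append:
  "u \<in> lists {1..n} \<Longrightarrow> v \<in> lists {1..n} \<Longrightarrow> mono (u @ v) = mono u \<otimes>\<^bsub>qaff K q n\<^esub> mono v"
  by (simp add: mono_def basis_F basis_mult flip: p.mult)

lemma mono_Nil: "mono [] = \<one>\<^bsub>qaff K q n\<^esub>"
  by (simp add: mono_def F_ops flip: p.one)

lemma mono_swap:
  assumes "i \<in> {1..n}" "j \<in> {1..n}" "i < j"
  shows "mono [i, j] = q \<odot>\<^bsub>qaff K q n\<^esub> mono [j, i]"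
proof -
  let ?r = "basis_elt K [i, j] \<ominus>\<^bsub>F\<^esub> q \<odot>\<^bsub>F\<^esub> basis_elt K [j, i]"
  have "?r = free_gen K i \<otimes>\<^bsub>F\<^esub> free_gen K j \<ominus>\<^bsub>F\<^esub> q \<odot>\<^bsub>F\<^esub> (free_gen K j \<otimes>\<^bsub>F\<^esub> free_gen K i)"
    using assms by (simp add: free_gen_def basis_mult)
  then have "?r \<in> qaff_rels K q n"
    using assms unfolding qaff_rels_def Let_def free_alg_def by auto
  then have "?r \<in> J" using F.genideal_self[OF rels_closed] by blast
  then have "J +>\<^bsub>F\<^esub> ?r = \<zero>\<^bsub>qaff K q n\<^esub>"
    unfolding qaff_eq using F.coset_eq_zero_iff[OF J_ideal] rels_closed \<open>?r \<in> qaff_rels K q n\<close> by blast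
  then show ?thesis using assms
    by (simp add: mono_def basis_F p.minus p.B.minus_eq_zero_iff)
qed

text \<open>The words \<open>[i, j]\<close> and \<open>[j, i]\<close> have the same content and the
  first has one ascent more, which the factor \<open>q\<close> in the relation cancels.\<close>

lemma J_null: "J \<subseteq> null_ideal"
proof (rule F.genideal_minimal[OF null_ideal subsetI])
  fix r assume r: "r \<in> qaff_rels K q n"
  then obtain i j where ij: "1 \<le> i" "i < j" "j \<le> n"
    and req: "r = basis_elt K [i, j] \<ominus>\<^bsub>F\<^esub> q \<odot>\<^bsub>F\<^esub> basis_elt K [j, i]"
    unfolding qaff_rels_def Let_def free_alg_def by (auto simp: free_gen_def basis_mult)
  have "coef e r = weight e [i, j] \<ominus> q \<otimes> weight e [j, i]" for e
    using ij by (simp add: req a_minus_def coef_add coef_a_inv coef_smult coef_basis basis_F)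
  moreover have "weight e [i, j] = q \<otimes> weight e [j, i]" for e
    using ij by (auto simp: weight_def add_mset_commute)
  ultimately have "coef e r = \<zero>" for e by (simp add: a_minus_def r_neg)
  then show "r \<in> null_ideal" using r rels_closed by (auto simp: null_ideal_def)
qed

text \<open>\<open>coef e\<close> read on quantum affine space; it descends because \<open>J\<close>
  lies in \<open>null_ideal\<close>.\<close>

definition qcoef where "qcoef e = quot_lift (coef e)"

lemma qcoef_coset:
  assumes "x \<in> carrier F"
  shows "qcoef e (J +>\<^bsub>F\<^esub> x) = coef e x"
  unfolding qcoef_def
proof (rule ideal.quot_lift_coset_eq[OF J_ideal _ assms])
  fix i assume "i \<in> J"
  then have "i \<in> null_ideal" using J_null by blast
  then show "coef e (i \<oplus>\<^bsub>F\<^esub> x) = coef e x"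
    using assms by (simp add: null_ideal_def coef_add)
qed

lemma qaff_cases:
  assumes "a \<in> carrier (qaff K q n)"
  obtains x where "x \<in> carrier F" "a = J +>\<^bsub>F\<^esub> x"
  using assms unfolding qaff_eq F.carrier_quot_alg by auto

lemma qcoef_closed [simp]: "a \<in> carrier (qaff K q n) \<Longrightarrow> qcoef e a \<in> carrier K"
  by (elim qaff_cases) (simp add: qcoef_coset)

lemma qcoef_add:
  assumes "a \<in> carrier (qaff K q n)" "a' \<in> carrier (qaff K q n)"
  shows "qcoef e (a \<oplus>\<^bsub>qaff K q n\<^esub> a') = qcoef e a \<oplus> qcoef e a'"
  using assms by (elim qaff_cases) (simp add: qcoef_coset coef_add flip: p.add)

lemma qcoef_smult:
  assumes "a \<in> carrier (qaff K q n)" "k \<in> carrier K"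
  shows "qcoef e (k \<odot>\<^bsub>qaff K q n\<^esub> a) = k \<otimes> qcoef e a"
  using assms by (elim qaff_cases) (simp add: qcoef_coset coef_smult flip: p.smult)

lemma qcoef_mono: "w \<in> lists {1..n} \<Longrightarrow> qcoef e (mono w) = weight e w"
  by (simp add: mono_def qcoef_coset basis_F coef_basis)

end

section \<open>Tensor products of algebras and bilinear forms\<close>

locale tensor_product = A: assoc_algebra K A + B: assoc_algebra K B
  for K (structure) and A (structure) and B (structure)
begin

sublocale mon_alg K "A \<times>\<times> B"
  by (intro mon_alg.intro A.R.is_cring DirProd_monoid A.monoid_axioms B.monoid_axioms)

sublocale F: assoc_algebra K F by (rule F_algebra)

abbreviation "N \<equiv> lin_span K F (bilinear_rels K A B)"

lemma rels_closed: "bilinear_rels K A B \<subseteq> carrier F"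
  and N_ideal: "ideal N F"
  using tensor_span_ideal[OF A.assoc_algebra_axioms B.assoc_algebra_axioms] by auto

lemma tensor_eq: "tensor_alg K A B = quot_alg F N"
  by (simp add: tensor_alg_def Let_def)

sublocale t: algebra_hom K F "tensor_alg K A B" "\<lambda>x. N +>\<^bsub>F\<^esub> x"
  unfolding tensor_eq by (rule F.coset_algebra_hom[OF N_ideal])

lemma DirProd_sel [simp]:
  "(a, b) \<in> carrier (A \<times>\<times> B) \<longleftrightarrow> a \<in> carrier A \<and> b \<in> carrier B"
  "(a, b) \<otimes>\<^bsub>A \<times>\<times> B\<^esub> (a', b') = (a \<otimes>\<^bsub>A\<^esub> a', b \<otimes>\<^bsub>B\<^esub> b')"
  "\<one>\<^bsub>A \<times>\<times> B\<^esub> = (\<one>\<^bsub>A\<^esub>, \<one>\<^bsub>B\<^esub>)"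
  by (simp_all add: DirProd_def)

lemma tensor_eqI:
  assumes "x \<ominus>\<^bsub>F\<^esub> y \<in> bilinear_rels K A B" "x \<in> carrier F" "y \<in> carrier F"
  shows "N +>\<^bsub>F\<^esub> x = N +>\<^bsub>F\<^esub> y"
proof -
  have "x \<ominus>\<^bsub>F\<^esub> y \<in> N" using assms(1) by (rule subsetD[OF lin_span_incl])
  then have "N +>\<^bsub>F\<^esub> (x \<ominus>\<^bsub>F\<^esub> y) = \<zero>\<^bsub>tensor_alg K A B\<^esub>"
    unfolding tensor_eq by (rule F.coset_eq_zero_iff[THEN iffD2, OF N_ideal F.minus_closed[OF assms(2,3)]])
  then have "(N +>\<^bsub>F\<^esub> x) \<ominus>\<^bsub>tensor_alg K A B\<^esub> (N +>\<^bsub>F\<^esub> y) = \<zero>\<^bsub>tensor_alg K A B\<^esub>"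
    by (simp only: t.minus[OF assms(2,3)])
  then show ?thesis
    by (rule t.B.minus_eq_zero_iff[THEN iffD1, OF t.closed[OF assms(2)] t.closed[OF assms(3)]])
qed

lemma tensor_smult_left:
  assumes "k \<in> carrier K" "a \<in> carrier A" "b \<in> carrier B"
  shows "N +>\<^bsub>F\<^esub> basis_elt K (k \<odot>\<^bsub>A\<^esub> a, b) = k \<odot>\<^bsub>tensor_alg K A B\<^esub> (N +>\<^bsub>F\<^esub> basis_elt K (a, b))"
proof -
  have "basis_elt K (k \<odot>\<^bsub>A\<^esub> a, b) \<ominus>\<^bsub>F\<^esub> k \<odot>\<^bsub>F\<^esub> basis_elt K (a, b) \<in> bilinear_rels K A B"
    unfolding bilinear_rels_def Let_def using assms by blast
  from tensor_eqI[OF this] show ?thesis using assms by (simp add: basis_F)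
qed

lemma tensor_smult_right:
  assumes "k \<in> carrier K" "a \<in> carrier A" "b \<in> carrier B"
  shows "N +>\<^bsub>F\<^esub> basis_elt K (a, k \<odot>\<^bsub>B\<^esub> b) = k \<odot>\<^bsub>tensor_alg K A B\<^esub> (N +>\<^bsub>F\<^esub> basis_elt K (a, b))"
proof -
  have "basis_elt K (a, k \<odot>\<^bsub>B\<^esub> b) \<ominus>\<^bsub>F\<^esub> k \<odot>\<^bsub>F\<^esub> basis_elt K (a, b) \<in> bilinear_rels K A B"
    unfolding bilinear_rels_def Let_def using assms by blast
  from tensor_eqI[OF this] show ?thesis using assms by (simp add: basis_F)
qed

text \<open>Universal property for scalar-valued forms: the linear extension of a bilinear
  \<open>\<phi>\<close> kills each bilinearity relation, hence their span. Tensors can then be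
  evaluated on lifts.\<close>

lemma bilinear_vanishes_on_span:
  assumes \<phi>: "\<And>a b. a \<in> carrier A \<Longrightarrow> b \<in> carrier B \<Longrightarrow> \<phi> (a, b) \<in> carrier K"
    and "\<And>a a' b. \<lbrakk>a \<in> carrier A; a' \<in> carrier A; b \<in> carrier B\<rbrakk> \<Longrightarrow> \<phi> (a \<oplus>\<^bsub>A\<^esub> a', b) = \<phi> (a, b) \<oplus> \<phi> (a', b)"
    and "\<And>a b b'. \<lbrakk>a \<in> carrier A; b \<in> carrier B; b' \<in> carrier B\<rbrakk> \<Longrightarrow> \<phi> (a, b \<oplus>\<^bsub>B\<^esub> b') = \<phi> (a, b) \<oplus> \<phi> (a, b')"
    and "\<And>k a b. \<lbrakk>k \<in> carrier K; a \<in> carrier A; b \<in> carrier B\<rbrakk> \<Longrightarrow> \<phi> (k \<odot>\<^bsub>A\<^esub> a, b) = k \<otimes> \<phi> (a, b)"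
    and "\<And>k a b. \<lbrakk>k \<in> carrier K; a \<in> carrier A; b \<in> carrier B\<rbrakk> \<Longrightarrow> \<phi> (a, k \<odot>\<^bsub>B\<^esub> b) = k \<otimes> \<phi> (a, b)"
    and "f \<in> N"
  shows "pair f \<phi> = \<zero>"
proof -
  have \<phi>': "\<phi> x \<in> carrier K" if "x \<in> carrier (A \<times>\<times> B)" for x
    using \<phi> that by (cases x) simp
  have pb: "pair (basis_elt K (a, b)) \<phi> = \<phi> (a, b)" if "a \<in> carrier A" "b \<in> carrier B" for a b
    by (rule pair_basis) (use that \<phi>' in auto)
  have pair_lin:
    "f \<in> carrier F \<Longrightarrow> g \<in> carrier F \<Longrightarrow> pair (f \<oplus>\<^bsub>F\<^esub> g) \<phi> = pair f \<phi> \<oplus> pair g \<phi>"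
    "f \<in> carrier F \<Longrightarrow> pair (\<ominus>\<^bsub>F\<^esub> f) \<phi> = \<ominus> pair f \<phi>"
    "f \<in> carrier F \<Longrightarrow> k \<in> carrier K \<Longrightarrow> pair (k \<odot>\<^bsub>F\<^esub> f) \<phi> = k \<otimes> pair f \<phi>" for f g k
    by (intro pair_add pair_a_inv pair_smult \<phi>'; assumption)+
  let ?H = "{f \<in> carrier F. pair f \<phi> = \<zero>}"
  have "submodule ?H K F" using \<phi>' by (rule pair_kernel_submodule)
  moreover have "bilinear_rels K A B \<subseteq> ?H"
  proof
    fix r assume r: "r \<in> bilinear_rels K A B"
    then have "r \<in> carrier F" using rels_closed by blast
    moreover have "pair r \<phi> = \<zero>"
      using r unfolding bilinear_rels_def Let_def
      by (elim UnE CollectE exE conjE)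
        (simp_all only: a_minus_def[of F], simp_all add: pair_lin pb basis_F assms(1-5) A.R.r_neg)
    ultimately show "r \<in> ?H" by simp
  qed
  ultimately have "N \<subseteq> ?H" by (rule F.lin_span_minimal)
  then show ?thesis using assms(6) by blast
qed

end

subsection \<open>The embedding\<close>

text \<open>Exponents add up over rows and columns and the content is a pair, so the functional
  factors.\<close>

lemma weight_matrix:
  assumes "field K" "q \<in> carrier K" "q \<noteq> \<zero>\<^bsub>K\<^esub>"
  shows "weighted_words.weight K matrix_content matrix_ascents q (d, e) w =
    weighted_words.weight K mset ascents q d (map fst w) \<otimes>\<^bsub>K\<^esub>
    weighted_words.weight K mset ascents q e (map snd w)"
proof -
  interpret A: weighted_words K undefined mset ascents cross_ascents q
    by (rule affine_weighted_words[OF assms])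
  interpret M: weighted_words K undefined matrix_content matrix_ascents
      "\<lambda>(r, s) (r', s'). cross_ascents r r' + cross_ascents s s'" q
    by (rule matrix_weighted_words[OF assms])
  show ?thesis
    by (auto simp: A.weight_def M.weight_def matrix_content_def matrix_ascents_def A.nat_pow_mult)
qed

text \<open>Noncommutative analogue of the Segre embedding of a product of projective
  spaces.\<close>

locale quantum_segre = field K for K (structure) + fixes q and m n :: nat
  assumes q [simp]: "q \<in> carrier K" "q \<noteq> \<zero>"
begin

sublocale rows: quantum_affine K q m
  by (intro quantum_affine.intro affine_weighted_words field_axioms q)

sublocale cols: quantum_affine K q n
  by (intro quantum_affine.intro affine_weighted_words field_axioms q)

sublocale W: weighted_words K "qmat_index m n" matrix_content matrix_ascents
    "\<lambda>(r, s) (r', s'). cross_ascents r r' + cross_ascents s s'" q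
  by (intro matrix_weighted_words field_axioms q)

sublocale T: tensor_product K "qaff K q m" "qaff K q n"
  by (intro tensor_product.intro rows.p.B.assoc_algebra_axioms cols.p.B.assoc_algebra_axioms)

lemma index_lists:
  assumes "w \<in> lists (qmat_index m n)"
  shows "map fst w \<in> lists {1..m}" "map snd w \<in> lists {1..n}"
  using assms by (fastforce simp: qmat_index_def)+

text \<open>Lifts a pure tensor to the algebra of the monoid of pairs. It is multiplicative in
  \<open>w\<close>, since rows and columns concatenate separately.\<close>

definition segre_word where "segre_word w = basis_elt K (rows.mono (map fst w), cols.mono (map snd w))"

lemma segre_word_closed: "w \<in> lists (qmat_index m n) \<Longrightarrow> segre_word w \<in> carrier T.F"
  unfolding segre_word_def by (intro T.basis_F) (simp only: T.DirProd_sel rows.mono_closed cols.mono_closed index_lists simp_thms)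

sublocale S: mon_alg_ext K "free_monoid (qmat_index m n)" T.F segre_word
proof (intro mon_alg_ext.intro mon_alg_ext_axioms.intro W.mon_alg_axioms T.F.assoc_algebra_axioms)
  fix w assume "w \<in> carrier (free_monoid (qmat_index m n))"
  then show "segre_word w \<in> carrier T.F" by (intro segre_word_closed) simp
qed

lemma S_hom: "algebra_hom K W.F T.F S.lin_ext"
proof (rule S.lin_ext_algebra_hom)
  fix u v assume "u \<in> carrier (free_monoid (qmat_index m n))" "v \<in> carrier (free_monoid (qmat_index m n))"
  then have uv: "u \<in> lists (qmat_index m n)" "v \<in> lists (qmat_index m n)" by simp_all
  note i = index_lists[OF uv(1)] index_lists[OF uv(2)]
  show "segre_word (u \<otimes>\<^bsub>free_monoid (qmat_index m n)\<^esub> v) = segre_word u \<otimes>\<^bsub>T.F\<^esub> segre_word v"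
    unfolding segre_word_def W.free_monoid_sel map_append rows.mono_append[OF i(1,3)] cols.mono_append[OF i(2,4)]
    by (subst T.basis_mult) (simp_all only: T.DirProd_sel rows.mono_closed cols.mono_closed i simp_thms)
next
  show "segre_word \<one>\<^bsub>free_monoid (qmat_index m n)\<^esub> = \<one>\<^bsub>T.F\<^esub>"
    unfolding segre_word_def W.free_monoid_sel list.map rows.mono_Nil cols.mono_Nil T.F_ops(4) T.DirProd_sel ..
qed

definition segre where "segre f = T.N +>\<^bsub>T.F\<^esub> S.lin_ext f"

lemma segre_hom: "algebra_hom K W.F (tensor_alg K (qaff K q m) (qaff K q n)) segre"
  unfolding segre_def by (rule algebra_hom_comp[OF S_hom T.t.algebra_hom_axioms])

sublocale segre: qmat_hom K q m n "tensor_alg K (qaff K q m) (qaff K q n)" segre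
  by (intro qmat_hom.intro qmat_hom_axioms.intro field_axioms q segre_hom[folded free_alg_def])

lemma segre_basis:
  "w \<in> lists (qmat_index m n) \<Longrightarrow>
    segre (basis_elt K w) = T.N +>\<^bsub>T.F\<^esub> basis_elt K (rows.mono (map fst w), cols.mono (map snd w))"
  by (simp add: segre_def S.lin_ext_basis segre_word_def)

lemma segre_mult_gens:
  assumes "(i, j) \<in> qmat_index m n" "(l, s) \<in> qmat_index m n"
  shows "segre.x i j \<otimes>\<^bsub>tensor_alg K (qaff K q m) (qaff K q n)\<^esub> segre.x l s =
    T.N +>\<^bsub>T.F\<^esub> basis_elt K (rows.mono [i, l], cols.mono [j, s])"
proof -
  have c: "basis_elt K [(i, j)] \<in> carrier W.F" "basis_elt K [(l, s)] \<in> carrier W.F"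
    using assms by (auto intro!: W.basis_F)
  have "basis_elt K [(i, j)] \<otimes>\<^bsub>W.F\<^esub> basis_elt K [(l, s)] = basis_elt K [(i, j), (l, s)]"
    using assms by (subst W.basis_mult) auto
  then have "segre (basis_elt K [(i, j), (l, s)]) = segre.x i j \<otimes>\<^bsub>tensor_alg K (qaff K q m) (qaff K q n)\<^esub> segre.x l s"
    using algebra_hom.mult[OF segre_hom c] by (simp add: segre.x_def free_gen_def)
  then show ?thesis using segre_basis[of "[(i, j), (l, s)]"] assms by simp
qed

text \<open>A product of two generators is a tensor of two monomials. A row exchange concerns only
  the left factor, where \<open>mono_swap\<close> yields a \<open>q\<close> that a bilinearity
  relation moves out; columns act likewise on the right factor.\<close>

lemma segre_exchange:
  "exchange_family K (tensor_alg K (qaff K q m) (qaff K q n)) q m n segre.x"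
proof (intro exchange_family.intro exchange_family_axioms.intro field_axioms q)
  show "assoc_algebra K (tensor_alg K (qaff K q m) (qaff K q n))" by (rule T.t.B.assoc_algebra_axioms)
  fix i j l s assume ij: "(i, j) \<in> qmat_index m n" and ls: "(l, s) \<in> qmat_index m n"
  then have I: "i \<in> {1..m}" "l \<in> {1..m}" "j \<in> {1..n}" "s \<in> {1..n}" by (auto simp: qmat_index_iff)
  have i_s: "(i, s) \<in> qmat_index m n" and lj: "(l, j) \<in> qmat_index m n" using I by (auto simp: qmat_index_iff)
  have mc: "rows.mono [l, i] \<in> carrier (qaff K q m)" "cols.mono [s, j] \<in> carrier (qaff K q n)"
     "rows.mono [i, l] \<in> carrier (qaff K q m)" "cols.mono [j, s] \<in> carrier (qaff K q n)"
    using I by (auto intro!: rows.mono_closed cols.mono_closed)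
  show "segre.x i j \<otimes>\<^bsub>tensor_alg K (qaff K q m) (qaff K q n)\<^esub> segre.x l s = q
      \<odot>\<^bsub>tensor_alg K (qaff K q m) (qaff K q n)\<^esub> (segre.x l j \<otimes>\<^bsub>tensor_alg K (qaff K q m) (qaff K q n)\<^esub> segre.x i s)"
    if "i < l"
    unfolding segre_mult_gens[OF ij ls] segre_mult_gens[OF lj i_s] rows.mono_swap[OF I(1,2) that]
    by (rule T.tensor_smult_left[OF q(1) mc(1,4)])
  show "segre.x i j \<otimes>\<^bsub>tensor_alg K (qaff K q m) (qaff K q n)\<^esub> segre.x l s = q
      \<odot>\<^bsub>tensor_alg K (qaff K q m) (qaff K q n)\<^esub> (segre.x i s \<otimes>\<^bsub>tensor_alg K (qaff K q m) (qaff K q n)\<^esub> segre.x l j)"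
    if "j < s"
    unfolding segre_mult_gens[OF ij ls] segre_mult_gens[OF i_s lj] cols.mono_swap[OF I(3,4) that]
    by (rule T.tensor_smult_right[OF q(1) mc(3,2)])
qed (rule segre.x_closed)

text \<open>\<open>segre f\<close> vanishes when the lift \<open>S.lin_ext f\<close> lies in the
  span of the bilinearity relations. A product of coefficient functionals is bilinear, hence zero
  there, and it pulls back to \<open>W.coef (d, e)\<close>.\<close>

lemma segre_kernel:
  assumes f: "f \<in> carrier W.F" and 0: "segre f = \<zero>\<^bsub>tensor_alg K (qaff K q m) (qaff K q n)\<^esub>"
  shows "f \<in> W.null_ideal"
proof -
  have "W.coef (d, e) f = \<zero>" for d e
  proof -
    define \<phi> where "\<phi> = (\<lambda>(a, b). rows.qcoef d a \<otimes> cols.qcoef e b)"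
    have \<phi>c: "\<phi> x \<in> carrier K" if "x \<in> carrier (qaff K q m \<times>\<times> qaff K q n)" for x
      using that by (cases x) (auto simp: \<phi>_def rows.qcoef_closed cols.qcoef_closed)
    interpret S: algebra_hom K W.F T.F S.lin_ext by (rule S_hom)
    have lin:
      "g \<in> carrier T.F \<Longrightarrow> g' \<in> carrier T.F \<Longrightarrow> T.pair (g \<oplus>\<^bsub>T.F\<^esub> g') \<phi> = T.pair g \<phi> \<oplus> T.pair g' \<phi>"
      "g \<in> carrier T.F \<Longrightarrow> T.pair (\<ominus>\<^bsub>T.F\<^esub> g) \<phi> = \<ominus> T.pair g \<phi>"
      "g \<in> carrier T.F \<Longrightarrow> k \<in> carrier K \<Longrightarrow> T.pair (k \<odot>\<^bsub>T.F\<^esub> g) \<phi> = k \<otimes> T.pair g \<phi>" for g g' k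
      by (intro T.pair_add T.pair_a_inv T.pair_smult \<phi>c; assumption)+
    \<comment> \<open>Two linear functionals on the free algebra are compared on words, where
      \<open>weight_matrix\<close> identifies them.\<close>
    let ?H = "{f \<in> carrier W.F. T.pair (S.lin_ext f) \<phi> = W.coef (d, e) f}"
    have "submodule ?H K W.F"
    proof (rule W.F.submoduleI)
      show "\<zero>\<^bsub>W.F\<^esub> \<in> ?H" by (simp add: T.pair_zero_elt W.coef_zero)
    next
      fix a assume "a \<in> ?H"
      then show "\<ominus>\<^bsub>W.F\<^esub> a \<in> ?H" by (simp add: lin W.coef_a_inv)
    next
      fix a b assume "a \<in> ?H" "b \<in> ?H"
      then show "a \<oplus>\<^bsub>W.F\<^esub> b \<in> ?H" by (simp add: lin W.coef_add)
    next
      fix k a assume "k \<in> carrier K" "a \<in> ?H"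
      then show "k \<odot>\<^bsub>W.F\<^esub> a \<in> ?H" by (simp add: lin W.coef_smult)
    qed auto
    then have "f \<in> ?H"
    proof (rule W.submodule_containing_basis)
      fix w assume "w \<in> carrier (free_monoid (qmat_index m n))"
      then have w: "w \<in> lists (qmat_index m n)" by simp
      note i = index_lists[OF w]
      have "T.pair (S.lin_ext (basis_elt K w)) \<phi> = \<phi> (rows.mono (map fst w), cols.mono (map snd w))"
        unfolding S.lin_ext_basis[OF \<open>w \<in> carrier _\<close>] segre_word_def
        by (rule T.pair_basis[OF _ \<phi>c]) (simp only: T.DirProd_sel rows.mono_closed cols.mono_closed i simp_thms)
      also have "\<dots> = W.coef (d, e) (basis_elt K w)"
        using i w by (simp add: \<phi>_def rows.qcoef_mono cols.qcoef_mono W.coef_basis weight_matrix[OF field_axioms q])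
      finally show "basis_elt K w \<in> ?H" using w by (simp add: W.basis_F)
    qed (rule f)
    moreover have "T.pair (S.lin_ext f) \<phi> = \<zero>"
    proof (rule T.bilinear_vanishes_on_span)
      show "S.lin_ext f \<in> T.N"
        using 0 T.F.coset_eq_zero_iff[OF T.N_ideal S.closed[OF f]] unfolding segre_def T.tensor_eq by blast
    qed (auto simp: \<phi>_def rows.qcoef_closed cols.qcoef_closed rows.qcoef_add cols.qcoef_add
          rows.qcoef_smult cols.qcoef_smult l_distr r_distr m_assoc m_lcomm)
    ultimately show ?thesis by simp
  qed
  then show ?thesis using f by (simp add: W.null_ideal_def)
qed

section \<open>The quotient by the quantum minors\<close>

abbreviation "R \<equiv> qmat K q m n"
abbreviation "T \<equiv> tensor_alg K (qaff K q m) (qaff K q n)"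
abbreviation "J \<equiv> Idl\<^bsub>W.F\<^esub> (qmat_rels K q m n)"
abbreviation "I \<equiv> qminor_ideal K q m n"

lemma rels_closed: "qmat_rels K q m n \<subseteq> carrier W.F"
  using qmat_rels_closed[OF field_axioms q] by (simp add: free_alg_def)

lemma J_ideal: "ideal J W.F"
  by (intro W.F.genideal_ideal rels_closed)

lemma qmat_eq: "R = quot_alg W.F J"
  by (simp add: qmat_def presented_alg_def free_alg_def)

sublocale to_R: algebra_hom K W.F R "\<lambda>f. J +>\<^bsub>W.F\<^esub> f"
  unfolding qmat_eq by (rule W.F.coset_algebra_hom[OF J_ideal])

lemma I_ideal: "ideal I R"
  by (rule quantum_algebras(3)[OF field_axioms q])

sublocale to_Q: algebra_hom K R "quot_alg R I" "\<lambda>x. I +>\<^bsub>R\<^esub> x"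
  by (rule to_R.B.coset_algebra_hom[OF I_ideal])

text \<open>Both quotient maps at once, so that questions about the quotient become questions about
  the free algebra.\<close>

definition proj where "proj f = I +>\<^bsub>R\<^esub> (J +>\<^bsub>W.F\<^esub> f)"

lemma proj_hom: "algebra_hom K W.F (quot_alg R I) proj"
  unfolding proj_def by (rule algebra_hom_comp[OF to_R.algebra_hom_axioms to_Q.algebra_hom_axioms])

sublocale proj: qmat_hom K q m n "quot_alg R I" proj
  by (intro qmat_hom.intro qmat_hom_axioms.intro field_axioms q proj_hom[folded free_alg_def])

lemma proj_surj: "carrier (quot_alg R I) = proj ` carrier W.F"
  unfolding to_R.B.carrier_quot_alg proj_def
  by (simp add: qmat_eq W.F.carrier_quot_alg image_image)

lemma free_minor_closed:
  assumes "{(i, j), (l, s)} \<subseteq> qmat_index m n"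
  shows "free_minor K q m n i l j s \<in> carrier W.F"
proof -
  have g: "free_gen K p \<in> carrier W.F" if "p \<in> qmat_index m n" for p
    using that by (simp add: free_gen_def W.basis_F)
  have "(i, s) \<in> qmat_index m n" "(l, j) \<in> qmat_index m n" using assms by (auto simp: qmat_index_iff)
  with assms g show ?thesis
    unfolding free_minor_def Let_def free_alg_def
    by (intro W.F.minus_closed W.F.smult_closed W.F.m_closed g q(1)) simp_all
qed

lemma coset_free_minor:
  assumes "{(i, j), (l, s)} \<subseteq> qmat_index m n"
  shows "J +>\<^bsub>W.F\<^esub> free_minor K q m n i l j s =
    qmat_gen K q m n i j \<otimes>\<^bsub>R\<^esub> qmat_gen K q m n l s \<ominus>\<^bsub>R\<^esub>
      q \<odot>\<^bsub>R\<^esub> (qmat_gen K q m n i s \<otimes>\<^bsub>R\<^esub> qmat_gen K q m n l j)"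
proof -
  interpret r: qmat_hom K q m n R "\<lambda>f. J +>\<^bsub>W.F\<^esub> f"
    unfolding free_alg_def
    by (intro qmat_hom.intro[unfolded free_alg_def] qmat_hom_axioms.intro field_axioms q to_R.algebra_hom_axioms)
  have "r.x a b = qmat_gen K q m n a b" for a b
    by (simp add: r.x_def qmat_gen_def presented_gen_def free_alg_def)
  then show ?thesis using r.h_minor[OF assms] by simp
qed

lemma qminors2_eq:
  "qminors2 K q m n = {J +>\<^bsub>W.F\<^esub> free_minor K q m n i l j s | i l j s.
    1 \<le> i \<and> i < l \<and> l \<le> m \<and> 1 \<le> j \<and> j < s \<and> s \<le> n}"
proof -
  have *: "{(i, j), (l, s)} \<subseteq> qmat_index m n"
    if "1 \<le> i \<and> i < l \<and> l \<le> m \<and> 1 \<le> j \<and> j < s \<and> s \<le> n" for i l j s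
    using that by (auto simp: qmat_index_iff)
  show ?thesis
    unfolding qminors2_def Let_def by (intro Collect_cong ex_cong1) (metis * coset_free_minor)
qed

lemma qminors2_closed: "qminors2 K q m n \<subseteq> carrier R"
  unfolding qminors2_eq by (auto intro!: to_R.closed free_minor_closed simp: qmat_index_iff)

text \<open>The inner quotient kills the defining relations, the outer one the minors.\<close>

lemma proj_exchange: "exchange_family K (quot_alg R I) q m n proj.x"
proof (rule proj.exchange_familyI)
  fix r assume "r \<in> qmat_rels K q m n"
  then have "r \<in> J" "r \<in> carrier W.F" using W.F.genideal_self[OF rels_closed] rels_closed by blast+
  then have "J +>\<^bsub>W.F\<^esub> r = \<zero>\<^bsub>R\<^esub>"
    unfolding qmat_eq by (simp add: W.F.coset_eq_zero_iff[OF J_ideal])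
  then show "proj r = \<zero>\<^bsub>quot_alg R I\<^esub>" by (simp add: proj_def to_Q.hom_zero)
next
  fix i l j s assume "1 \<le> i" "i < l" "l \<le> m" "1 \<le> j" "j < s" "s \<le> n"
  then have "J +>\<^bsub>W.F\<^esub> free_minor K q m n i l j s \<in> qminors2 K q m n"
    unfolding qminors2_eq by blast
  then have "J +>\<^bsub>W.F\<^esub> free_minor K q m n i l j s \<in> I" "J +>\<^bsub>W.F\<^esub> free_minor K q m n i l j s \<in> carrier R"
    unfolding qminor_ideal_def using to_R.B.genideal_self[OF qminors2_closed] qminors2_closed by blast+
  then show "proj (free_minor K q m n i l j s) = \<zero>\<^bsub>quot_alg R I\<^esub>"
    unfolding proj_def by (simp add: to_R.B.coset_eq_zero_iff[OF I_ideal])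
qed

text \<open>The exchange rules imply the defining relations, so the map descends to quantum
  matrices; \<open>segre_R_I\<close> does the same with the minors for the second descent.\<close>

lemma segre_J: "f \<in> J \<Longrightarrow> segre f = \<zero>\<^bsub>T\<^esub>"
  by (rule algebra_hom.genideal_kernel[OF segre_hom rels_closed segre.exchange_rels[OF segre_exchange]])

definition segre_R where "segre_R = quot_lift segre"

lemma segre_R_hom: "algebra_hom K R T segre_R"
  unfolding segre_R_def qmat_eq
  by (rule algebra_hom.quot_lift_algebra_hom[OF segre_hom J_ideal segre_J])

lemma segre_R_coset: "f \<in> carrier W.F \<Longrightarrow> segre_R (J +>\<^bsub>W.F\<^esub> f) = segre f"
  unfolding segre_R_def by (rule algebra_hom.quot_lift_coset[OF segre_hom J_ideal segre_J])

lemma segre_R_I: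
  assumes "x \<in> I"
  shows "segre_R x = \<zero>\<^bsub>T\<^esub>"
proof (rule algebra_hom.genideal_kernel[OF segre_R_hom qminors2_closed _ assms[unfolded qminor_ideal_def]])
  fix y assume "y \<in> qminors2 K q m n"
  then obtain i l j s where y: "y = J +>\<^bsub>W.F\<^esub> free_minor K q m n i l j s"
    and b: "1 \<le> i" "i < l" "l \<le> m" "1 \<le> j" "j < s" "s \<le> n"
    unfolding qminors2_eq by blast
  have "free_minor K q m n i l j s \<in> carrier W.F"
    by (rule free_minor_closed) (use b in \<open>auto simp: qmat_index_iff\<close>)
  then show "segre_R y = \<zero>\<^bsub>T\<^esub>"
    unfolding y using segre.exchange_minors[OF segre_exchange b] by (simp add: segre_R_coset)
qed

definition segre_Q where "segre_Q = quot_lift segre_R"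

sublocale segre_Q: algebra_hom K "quot_alg R I" T segre_Q
  unfolding segre_Q_def
  by (rule algebra_hom.quot_lift_algebra_hom[OF segre_R_hom I_ideal segre_R_I])

lemma segre_Q_proj:
  assumes "f \<in> carrier W.F"
  shows "segre_Q (proj f) = segre f"
  unfolding segre_Q_def proj_def
  using algebra_hom.quot_lift_coset[OF segre_R_hom I_ideal segre_R_I to_R.closed[OF assms]]
  by (simp add: segre_R_coset[OF assms])

text \<open>The inclusions form a cycle: the kernel of \<open>proj\<close> lies in that of
  \<open>segre\<close>, which factors through the quotient; the latter lies in
  \<open>W.null_ideal\<close> by the coefficient functionals; and normal forms lead back to the
  kernel of \<open>proj\<close>.\<close>

lemma proj_eq_zero_iff:
  assumes f: "f \<in> carrier W.F"
  shows "proj f = \<zero>\<^bsub>quot_alg R I\<^esub> \<longleftrightarrow> f \<in> W.null_ideal"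
proof
  assume "proj f = \<zero>\<^bsub>quot_alg R I\<^esub>"
  then have "segre f = \<zero>\<^bsub>T\<^esub>" using segre_Q_proj[OF f] segre_Q.hom_zero by simp
  then show "f \<in> W.null_ideal" by (rule segre_kernel[OF f])
next
  assume "f \<in> W.null_ideal"
  then show "proj f = \<zero>\<^bsub>quot_alg R I\<^esub>" by (rule proj.exchange_null[OF proj_exchange])
qed

text \<open>The difference is lifted to some \<open>f\<close> in the free algebra; once
  \<open>segre f\<close> vanishes, \<open>f\<close> lies in \<open>W.null_ideal\<close>, which
  \<open>proj\<close> kills.\<close>

lemma segre_Q_inj: "inj_on segre_Q (carrier (quot_alg R I))"
proof (rule inj_onI)
  fix a b assume a: "a \<in> carrier (quot_alg R I)" and b: "b \<in> carrier (quot_alg R I)"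
    and eq: "segre_Q a = segre_Q b"
  have "a \<ominus>\<^bsub>quot_alg R I\<^esub> b \<in> carrier (quot_alg R I)" using a b by (rule to_Q.B.minus_closed)
  then obtain f where f: "f \<in> carrier W.F" "proj f = a \<ominus>\<^bsub>quot_alg R I\<^esub> b" unfolding proj_surj by auto
  have "segre f = segre_Q a \<ominus>\<^bsub>T\<^esub> segre_Q b"
    using segre_Q_proj[OF f(1)] segre_Q.minus[OF a b] f(2) by simp
  then have "segre f = \<zero>\<^bsub>T\<^esub>"
    using T.t.B.minus_eq_zero_iff[OF segre_Q.closed[OF a] segre_Q.closed[OF b]] eq by simp
  then have "proj f = \<zero>\<^bsub>quot_alg R I\<^esub>" using segre_kernel[OF f(1)] proj_eq_zero_iff[OF f(1)] by blast
  then show "a = b" using f(2) to_Q.B.minus_eq_zero_iff[OF a b] by simp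
qed

text \<open>The quotient is the free algebra modulo \<open>W.null_ideal\<close>, whose primeness
  comes from leading terms.\<close>

lemma completely_prime: "completely_prime I R"
  unfolding completely_prime_def noncomm_domain_def
proof (intro conjI ballI impI)
  show "ideal I R" by (rule I_ideal)
  then show "ring (R Quot I)" by (rule ideal.quotient_is_ring)
  \<comment> \<open>The ring quotient and the algebra quotient share their ring operations;
    \<open>sel\<close> passes to the latter, the target of \<open>proj\<close>.\<close>
  note sel = quot_alg_sel[of R I, symmetric]
  interpret p: algebra_hom K W.F "quot_alg R I" proj by (rule proj_hom)
  show "\<one>\<^bsub>R Quot I\<^esub> \<noteq> \<zero>\<^bsub>R Quot I\<^esub>"
    unfolding sel using proj_eq_zero_iff[OF W.F.one_closed] W.one_notin_null_ideal p.one by simp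
  fix a b assume "a \<in> carrier (R Quot I)" "b \<in> carrier (R Quot I)"
    and 0: "a \<otimes>\<^bsub>R Quot I\<^esub> b = \<zero>\<^bsub>R Quot I\<^esub>"
  then obtain f g where f: "f \<in> carrier W.F" "a = proj f" and g: "g \<in> carrier W.F" "b = proj g"
    unfolding sel proj_surj by auto
  have "proj (f \<otimes>\<^bsub>W.F\<^esub> g) = \<zero>\<^bsub>quot_alg R I\<^esub>"
    using 0 f g p.mult unfolding sel by simp
  then have "f \<otimes>\<^bsub>W.F\<^esub> g \<in> W.null_ideal"
    using proj_eq_zero_iff[OF W.F.m_closed[OF f(1) g(1)]] by simp
  then have "f \<in> W.null_ideal \<or> g \<in> W.null_ideal"
    using W.null_ideal_prime f(1) g(1) by blast
  then show "a = \<zero>\<^bsub>R Quot I\<^esub> \<or> b = \<zero>\<^bsub>R Quot I\<^esub>"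
    unfolding sel using proj_eq_zero_iff f g by blast
qed

end

theorem theorem1p1:
  fixes K :: "('k, 'c) ring_scheme" and q :: 'k and m n :: nat
  assumes "field K"
    and "q \<in> carrier K" and "q \<noteq> \<zero>\<^bsub>K\<^esub>"
    and "1 \<le> m" and "1 \<le> n"
  shows "(\<exists>S h. is_subalgebra K S (tensor_alg K (qaff K q m) (qaff K q n)) \<and>
            h \<in> alg_iso K (quot_alg (qmat K q m n) (qminor_ideal K q m n))
                  ((tensor_alg K (qaff K q m) (qaff K q n))\<lparr>carrier := S\<rparr>))
         \<and> completely_prime (qminor_ideal K q m n) (qmat K q m n)"
proof -
  interpret quantum_segre K q m n
    by (intro quantum_segre.intro quantum_segre_axioms.intro assms)
  \<comment> \<open>The subalgebra is the image of the quotient under the induced injection.\<close>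
  have "segre_Q \<in> alg_iso K (quot_alg R I) (T\<lparr>carrier := segre_Q ` carrier (quot_alg R I)\<rparr>)"
    using segre_Q.hom segre_Q_inj
    by (auto simp: alg_iso_def alg_hom_def ring_hom_def bij_betw_def)
  then show ?thesis using segre_Q.image_subalgebra completely_prime by blast
qed

end
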